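(* Let $p\colon X\to Y$ be an inner fibration of semisimplicial sets and $f\colon A\to X$ the inclusion of a semisimplicial subset; assume that $Y$ and $A$ have simplicial structures such that $p\circ f$ is a simplicial map. Let $s_0\colon X_0\to X_1$ be a map, compatible with the degeneracies $s_0$ on $A$ and $Y$ (that is, $s_0(f(a))=f(s_0(a))$ for all $a\in A_0$ and $p(s_0(x))=s_0(p(x))$ for all $x\in X_0$), and such that for all $x\in X_0$, $s_0(x)$ is an edge $x\to x$ which is $p$-idempotent, $p$-cartesian, and $p$-cocartesian. Then $s_0\colon X_0\to X_1$ extends to a simplicial structure on $X$ such that $f$ and $p$ are simplicial.
   Context: A semisimplicial set is a contravariant functor to sets from the category of the finite ordered sets $[n]=\{0,\dots,n\}$ and strictly monotone maps; it has face maps $d_i$ but no degeneracies. $\Delta^n$ denotes the semisimplicial $n$-simplex (presheaf represented by $[n]$), and $\Lambda^n_i\subset\Delta^n$ the $(n,i)$-horn (the union of all codimension-one faces of $\Delta^n$ except the $i$-th one). A simplicial structure on a semisimplicial set is a collection of degeneracy maps making it, with its given face maps, a simplicial set. For $f\in X_1$ write $f\colon x\to y$ where $x=d_1f$, $y=d_0f$. Given a semisimplicial map $p\colon X\to Y$, consider commutative squares consisting of $h\colon \Lambda^n_i\to X$, $k\colon\Delta^n\to Y$ with $p\circ h=k|_{\Lambda^n_i}$; a diagonal lift is a map $\ell\colon\Delta^n\to X$ with $\ell|_{\Lambda^n_i}=h$ and $p\circ\ell=k$. The map $p$ is an inner fibration if every such square with $0<i<n$ has a diagonal lift. An element $a\in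 X_1$ is $p$-cartesian if every such square with $n\ge2$, $i=n$, and with last edge $\{n-1,n\}$ of $h$ equal to $a$ has a diagonal lift; it is $p$-cocartesian if, dually, every such square with $n\ge 2$, $i=0$, and with first edge $\{0,1\}$ of $h$ equal to $a$ has a diagonal lift. If $Y$ has a simplicial structure, a 1-simplex $e\colon x\to x$ in $X$ is $p$-idempotent if there is $\sigma\in X_2$ all of whose three faces are $e$ and which projects under $p$ to the degenerate simplex $s_0^2(p(x))\in Y_2$. *)

theory Defs
  imports Main "HOL-Library.FuncSet"
begin

text \<open>
  The ordered set \<open>[n]\<close> is \<open>{..n}\<close>. Maps out of it are extensional (\<open>undefined\<close> outside
  \<open>{..n}\<close>), so that equality of HOL functions is equality of morphisms.
\<close>

definition inj_maps :: "nat \<Rightarrow> nat \<Rightarrow> (nat \<Rightarrow> nat) set" where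
  "inj_maps m n = {\<alpha> \<in> {..m} \<rightarrow>\<^sub>E {..n}. strict_mono_on {..m} \<alpha>}"

definition coface :: "nat \<Rightarrow> nat \<Rightarrow> nat \<Rightarrow> nat" where
  "coface n i = (\<lambda>k\<in>{..n - 1}. if k < i then k else Suc k)"

text \<open>
  A graded set together with, for each strictly monotone \<open>\<alpha> : [m] \<rightarrow> [n]\<close>, a map
  \<open>act X m n \<alpha>\<close> from \<open>n\<close>-simplices to \<open>m\<close>-simplices. All maps are only relevant on the
  indicated carriers. The simplices of all dimensions live in one type, but
  the carriers in different dimensions need not be disjoint.
\<close>

record 'a semisimplicial =
  simplices :: "nat \<Rightarrow> 'a set"
  act :: "nat \<Rightarrow> nat \<Rightarrow> (nat \<Rightarrow> nat) \<Rightarrow> 'a \<Rightarrow> 'a"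

definition semisimplicial_set :: "'a semisimplicial \<Rightarrow> bool" where
  "semisimplicial_set X \<longleftrightarrow>
     (\<forall>m n. \<forall>\<alpha>\<in>inj_maps m n. act X m n \<alpha> \<in> simplices X n \<rightarrow> simplices X m) \<and>
     (\<forall>n. \<forall>x\<in>simplices X n. act X n n (\<lambda>k\<in>{..n}. k) x = x) \<and>
     (\<forall>l m n. \<forall>\<alpha>\<in>inj_maps l m. \<forall>\<beta>\<in>inj_maps m n. \<forall>x\<in>simplices X n.
        act X l n (compose {..l} \<beta> \<alpha>) x = act X l m \<alpha> (act X m n \<beta> x))"

text \<open>The face map \<open>d\<^sub>i\<close> on \<open>n\<close>-simplices, for \<open>n \<ge> 1\<close> and \<open>i \<le> n\<close>.\<close>

definition face :: "'a semisimplicial \<Rightarrow> nat \<Rightarrow> nat \<Rightarrow> 'a \<Rightarrow> 'a" where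
  "face X n i = act X (n - 1) n (coface n i)"

definition semisimplicial_map ::
  "'a semisimplicial \<Rightarrow> 'b semisimplicial \<Rightarrow> (nat \<Rightarrow> 'a \<Rightarrow> 'b) \<Rightarrow> bool" where
  "semisimplicial_map X Y p \<longleftrightarrow>
     (\<forall>n. p n \<in> simplices X n \<rightarrow> simplices Y n) \<and>
     (\<forall>m n. \<forall>\<alpha>\<in>inj_maps m n. \<forall>x\<in>simplices X n.
        p m (act X m n \<alpha> x) = act Y m n \<alpha> (p n x))"

definition semisimplicial_subset :: "'a semisimplicial \<Rightarrow> 'a semisimplicial \<Rightarrow> bool" where
  "semisimplicial_subset A X \<longleftrightarrow> semisimplicial_set A \<and>
     (\<forall>n. simplices A n \<subseteq> simplices X n) \<and>
     (\<forall>m n. \<forall>\<alpha>\<in>inj_maps m n. \<forall>a\<in>simplices A n. act A m n \<alpha> a = act X m n \<alpha> a)"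

definition inclusion :: "nat \<Rightarrow> 'a \<Rightarrow> 'a" where
  "inclusion n x = x"

text \<open>
  The degeneracy \<open>s n i\<close> is the map \<open>s\<^sub>i\<close> from \<open>n\<close>-simplices to \<open>(n + 1)\<close>-simplices, for
  \<open>i \<le> n\<close>; the conditions are the simplicial identities that involve degeneracies (those
  between the face maps hold in any semisimplicial set).
\<close>

definition simplicial_structure ::
  "'a semisimplicial \<Rightarrow> (nat \<Rightarrow> nat \<Rightarrow> 'a \<Rightarrow> 'a) \<Rightarrow> bool" where
  "simplicial_structure X s \<longleftrightarrow>
     (\<forall>n. \<forall>i\<le>n. s n i \<in> simplices X n \<rightarrow> simplices X (Suc n)) \<and>
     (\<forall>n. \<forall>j\<le>n. \<forall>i<j. \<forall>x\<in>simplices X n.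
        face X (Suc n) i (s n j x) = s (n - 1) (j - 1) (face X n i x)) \<and>
     (\<forall>n. \<forall>j\<le>n. \<forall>x\<in>simplices X n.
        face X (Suc n) j (s n j x) = x \<and> face X (Suc n) (Suc j) (s n j x) = x) \<and>
     (\<forall>n. \<forall>i\<le>Suc n. \<forall>j. Suc j < i \<longrightarrow> (\<forall>x\<in>simplices X n.
        face X (Suc n) i (s n j x) = s (n - 1) j (face X n (i - 1) x))) \<and>
     (\<forall>n. \<forall>j\<le>n. \<forall>i\<le>j. \<forall>x\<in>simplices X n.
        s (Suc n) i (s n j x) = s (Suc n) (Suc j) (s n i x))"

definition simplicial_map ::
  "'a semisimplicial \<Rightarrow> (nat \<Rightarrow> nat \<Rightarrow> 'a \<Rightarrow> 'a) \<Rightarrow>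
   'b semisimplicial \<Rightarrow> (nat \<Rightarrow> nat \<Rightarrow> 'b \<Rightarrow> 'b) \<Rightarrow> (nat \<Rightarrow> 'a \<Rightarrow> 'b) \<Rightarrow> bool" where
  "simplicial_map X sX Y sY p \<longleftrightarrow> semisimplicial_map X Y p \<and>
     (\<forall>n. \<forall>i\<le>n. \<forall>x\<in>simplices X n. p (Suc n) (sX n i x) = sY n i (p n x))"

definition std_simplex :: "nat \<Rightarrow> (nat \<Rightarrow> nat) semisimplicial" where
  "std_simplex n =
     \<lparr>simplices = (\<lambda>m. inj_maps m n), act = (\<lambda>l m \<alpha> \<beta>. compose {..l} \<beta> \<alpha>)\<rparr>"

text \<open>The \<open>j\<close>-th codimension-one face of the simplex consists of the maps that miss \<open>j\<close>.\<close>

definition horn :: "nat \<Rightarrow> nat \<Rightarrow> (nat \<Rightarrow> nat) semisimplicial" where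
  "horn n i = (std_simplex n)
     \<lparr>simplices := \<lambda>m. \<Union>j\<in>{..n} - {i}. {\<alpha> \<in> inj_maps m n. j \<notin> \<alpha> ` {..m}}\<rparr>"

definition edge :: "nat \<Rightarrow> nat \<Rightarrow> nat \<Rightarrow> nat" where
  "edge a b = (\<lambda>k\<in>{..1}. if k = 0 then a else b)"

definition horn_square ::
  "'a semisimplicial \<Rightarrow> 'b semisimplicial \<Rightarrow> (nat \<Rightarrow> 'a \<Rightarrow> 'b) \<Rightarrow> nat \<Rightarrow> nat \<Rightarrow>
   (nat \<Rightarrow> (nat \<Rightarrow> nat) \<Rightarrow> 'a) \<Rightarrow> (nat \<Rightarrow> (nat \<Rightarrow> nat) \<Rightarrow> 'b) \<Rightarrow> bool" where
  "horn_square X Y p n i h k \<longleftrightarrow>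
     semisimplicial_map (horn n i) X h \<and> semisimplicial_map (std_simplex n) Y k \<and>
     (\<forall>m. \<forall>\<alpha>\<in>simplices (horn n i) m. p m (h m \<alpha>) = k m \<alpha>)"

definition diagonal_lift ::
  "'a semisimplicial \<Rightarrow> 'b semisimplicial \<Rightarrow> (nat \<Rightarrow> 'a \<Rightarrow> 'b) \<Rightarrow> nat \<Rightarrow> nat \<Rightarrow>
   (nat \<Rightarrow> (nat \<Rightarrow> nat) \<Rightarrow> 'a) \<Rightarrow> (nat \<Rightarrow> (nat \<Rightarrow> nat) \<Rightarrow> 'b) \<Rightarrow>
   (nat \<Rightarrow> (nat \<Rightarrow> nat) \<Rightarrow> 'a) \<Rightarrow> bool" where
  "diagonal_lift X Y p n i h k l \<longleftrightarrow>
     semisimplicial_map (std_simplex n) X l \<and>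
     (\<forall>m. \<forall>\<alpha>\<in>simplices (horn n i) m. l m \<alpha> = h m \<alpha>) \<and>
     (\<forall>m. \<forall>\<alpha>\<in>simplices (std_simplex n) m. p m (l m \<alpha>) = k m \<alpha>)"

definition inner_fibration ::
  "'a semisimplicial \<Rightarrow> 'b semisimplicial \<Rightarrow> (nat \<Rightarrow> 'a \<Rightarrow> 'b) \<Rightarrow> bool" where
  "inner_fibration X Y p \<longleftrightarrow> semisimplicial_map X Y p \<and>
     (\<forall>n i h k. 0 < i \<and> i < n \<and> horn_square X Y p n i h k
        \<longrightarrow> (\<exists>l. diagonal_lift X Y p n i h k l))"

definition cartesian ::
  "'a semisimplicial \<Rightarrow> 'b semisimplicial \<Rightarrow> (nat \<Rightarrow> 'a \<Rightarrow> 'b) \<Rightarrow> 'a \<Rightarrow> bool" where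
  "cartesian X Y p a \<longleftrightarrow> a \<in> simplices X 1 \<and>
     (\<forall>n h k. 2 \<le> n \<and> horn_square X Y p n n h k \<and> h 1 (edge (n - 1) n) = a
        \<longrightarrow> (\<exists>l. diagonal_lift X Y p n n h k l))"

definition cocartesian ::
  "'a semisimplicial \<Rightarrow> 'b semisimplicial \<Rightarrow> (nat \<Rightarrow> 'a \<Rightarrow> 'b) \<Rightarrow> 'a \<Rightarrow> bool" where
  "cocartesian X Y p a \<longleftrightarrow> a \<in> simplices X 1 \<and>
     (\<forall>n h k. 2 \<le> n \<and> horn_square X Y p n 0 h k \<and> h 1 (edge 0 1) = a
        \<longrightarrow> (\<exists>l. diagonal_lift X Y p n 0 h k l))"

definition edge_from_to :: "'a semisimplicial \<Rightarrow> 'a \<Rightarrow> 'a \<Rightarrow> 'a \<Rightarrow> bool" where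
  "edge_from_to X e x y \<longleftrightarrow> e \<in> simplices X 1 \<and> face X 1 1 e = x \<and> face X 1 0 e = y"

definition idempotent ::
  "'a semisimplicial \<Rightarrow> 'b semisimplicial \<Rightarrow> (nat \<Rightarrow> nat \<Rightarrow> 'b \<Rightarrow> 'b) \<Rightarrow>
   (nat \<Rightarrow> 'a \<Rightarrow> 'b) \<Rightarrow> 'a \<Rightarrow> bool" where
  "idempotent X Y sY p e \<longleftrightarrow>
     (\<exists>x\<in>simplices X 0. edge_from_to X e x x \<and>
        (\<exists>\<sigma>\<in>simplices X 2. (\<forall>i\<le>2. face X 2 i \<sigma> = e) \<and>
           p 2 \<sigma> = sY 1 0 (sY 0 0 (p 0 x))))"

end

theory Submission
  imports Defs
begin

text \<open>
  A weakly monotone map \<open>[k] \<rightarrow> [m]\<close> is a sorted list of \<open>k + 1\<close> vertices of the \<open>m\<close>-simplex. A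
  simplicial structure on \<open>X\<close> amounts to simplices \<open>y\<cdot>l\<close>, for \<open>y\<close> an \<open>m\<close>-simplex and \<open>l\<close> such a
  list, whose faces are obtained by deleting entries of \<open>l\<close> and whose degeneracies are obtained by
  repeating entries. The structure is built by induction on \<open>m\<close>, starting with \<open>A\<close>: given a simplicial
  subset \<open>B\<close> that contains all simplices of dimension less than \<open>m\<close>, every \<open>m\<close>-simplex \<open>y\<close> outside \<open>B\<close>
  is attached together with all its degeneracies. If \<open>l\<close> misses a vertex, then \<open>y\<cdot>l\<close> is a degeneracy
  of a proper face of \<open>y\<close> and hence given; the \<open>y\<cdot>l\<close> with \<open>l\<close> surjective must be chosen, and as they are
  automatically distinct and outside \<open>B\<close>, no coherence other than that of their faces is at stake.

  The difficulty is that all faces of \<open>y\<cdot>l\<close> are prescribed, whereas the hypotheses only fill horns. Two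
  constructions overcome it. In both, a block of equal vertices \<open>b\<close> of \<open>l\<close> is enlarged, and the other
  faces of the simplices that occur have been chosen before.
  \<^item> A boundary in which \<open>b\<close> occurs twice is filled as follows (\<open>filler_of_repeated_vertex\<close>).
    Filling a horn of \<open>\<dots>bb\<dots>\<close> gives a simplex \<open>t\<close> in which one face is possibly wrong. In the list
    \<open>\<dots>bbb\<dots>\<close> one uses \<open>t\<close> for two adjacent faces, which meet precisely in the wrong face; the third
    face obtained by filling this horn has the required boundary.
  \<^item> A boundary in which \<open>b\<close> occurs at least three times need not be fillable: if \<open>b\<close> occurs an odd
    number of times, filling it forces the class of the simplex that occurs as the repeated face, up to
    homotopy relative to its boundary. So each simplex has to be chosen with the next one in mind. By
    \<open>replace_filler\<close> this is always possible: a filler of the boundary of \<open>l\<close> can be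
    replaced by one such that the boundary with one more \<open>b\<close>, formed with it, can be filled.

  Carrying along the property that one more repetition is possible (\<open>extendable\<close>), all degeneracies
  of \<open>y\<close> are chosen by well-founded recursion (\<open>degenerate_simplices_exist\<close>). Only the edge
  \<open>s\<^sub>0 y\<close> of a vertex is given in advance, and for it this property is idempotency. The
  horns in question are inner, or they are outer and their critical edge is a value of \<open>s\<^sub>0\<close>, so
  that it is cartesian and cocartesian.
\<close>

section \<open>Faces of semisimplicial sets\<close>

lemma coface_in_inj_maps: "\<lbrakk>1 \<le> n; i \<le> n\<rbrakk> \<Longrightarrow> coface n i \<in> inj_maps (n - 1) n"
  by (auto simp: coface_def inj_maps_def strict_mono_on_def split: if_splits)

lemma identity_in_inj_maps: "(\<lambda>k\<in>{..n}. k) \<in> inj_maps n n"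
  by (auto simp: inj_maps_def strict_mono_on_def)

lemma compose_in_inj_maps:
  assumes "\<alpha> \<in> inj_maps l m" "\<beta> \<in> inj_maps m n"
  shows "compose {..l} \<beta> \<alpha> \<in> inj_maps l n"
proof -
  have "\<And>k. k \<le> l \<Longrightarrow> \<alpha> k \<le> m" using assms(1) by (auto simp: inj_maps_def)
  then show ?thesis using assms
    by (auto simp: inj_maps_def strict_mono_on_def compose_def PiE_def Pi_def)
qed

lemma edge_in_inj_maps: "\<lbrakk>a < b; b \<le> n\<rbrakk> \<Longrightarrow> edge a b \<in> inj_maps 1 n"
  by (auto simp: inj_maps_def edge_def strict_mono_on_def split: if_splits)

lemma inj_maps_eqI:
  assumes "\<alpha> \<in> inj_maps m n" "\<beta> \<in> inj_maps m n" "\<And>k. k \<le> m \<Longrightarrow> \<alpha> k = \<beta> k"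
  shows "\<alpha> = \<beta>"
  using assms by (intro PiE_ext[of \<alpha> "{..m}" "\<lambda>_. {..n}" \<beta>]) (auto simp: inj_maps_def)

lemma semisimplicial_setD:
  assumes "semisimplicial_set X"
  shows "\<And>m n \<alpha> x. \<lbrakk>\<alpha> \<in> inj_maps m n; x \<in> simplices X n\<rbrakk> \<Longrightarrow> act X m n \<alpha> x \<in> simplices X m"
    and "\<And>n x. x \<in> simplices X n \<Longrightarrow> act X n n (\<lambda>k\<in>{..n}. k) x = x"
    and "\<And>l m n \<alpha> \<beta> x. \<lbrakk>\<alpha> \<in> inj_maps l m; \<beta> \<in> inj_maps m n; x \<in> simplices X n\<rbrakk>
      \<Longrightarrow> act X l m \<alpha> (act X m n \<beta> x) = act X l n (compose {..l} \<beta> \<alpha>) x"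
  using assms unfolding semisimplicial_set_def by (auto simp: Pi_iff)

lemma face_in_simplices:
  assumes "semisimplicial_set X" "1 \<le> n" "i \<le> n" "x \<in> simplices X n"
  shows "face X n i x \<in> simplices X (n - 1)"
  unfolding face_def using semisimplicial_setD(1)[OF assms(1) coface_in_inj_maps[OF assms(2,3)]] assms(4) .

text \<open>
  Stated for arbitrary \<open>\<beta>\<close> that agrees with the composite, so that the composites below need not
  be normalised as functions.
\<close>

lemma act_face:
  assumes "semisimplicial_set X" "1 \<le> n" "i \<le> n" "x \<in> simplices X n"
    and "\<alpha> \<in> inj_maps m (n - 1)" "\<beta> \<in> inj_maps m n"
    and "\<And>k. k \<le> m \<Longrightarrow> \<beta> k = (if \<alpha> k < i then \<alpha> k else Suc (\<alpha> k))"
  shows "act X m (n - 1) \<alpha> (face X n i x) = act X m n \<beta> x"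
proof -
  have "\<And>k. k \<le> m \<Longrightarrow> \<alpha> k \<le> n - 1" using assms(5) by (auto simp: inj_maps_def)
  then have "compose {..m} (coface n i) \<alpha> = \<beta>"
    using assms(7)
    by (intro inj_maps_eqI[OF compose_in_inj_maps[OF assms(5) coface_in_inj_maps[OF assms(2,3)]] assms(6)])
      (auto simp: compose_def coface_def)
  then show ?thesis
    unfolding face_def
    using semisimplicial_setD(3)[OF assms(1,5) coface_in_inj_maps[OF assms(2,3)] assms(4)] by simp
qed

lemma face_face:
  assumes "semisimplicial_set X" "2 \<le> n" "i < j" "j \<le> n" "x \<in> simplices X n"
  shows "face X (n - 1) i (face X n j x) = face X (n - 1) (j - 1) (face X n i x)"
proof -
  let ?\<beta> = "compose {..n - 2} (coface n j) (coface (n - 1) i)"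
  have c: "coface (n - 1) k \<in> inj_maps (n - 2) (n - 1)" if "k \<le> n - 1" for k
    using coface_in_inj_maps[of "n - 1" k] that assms by (simp add: numeral_2_eq_2)
  have b: "?\<beta> \<in> inj_maps (n - 2) n"
    using assms by (intro compose_in_inj_maps[OF c coface_in_inj_maps]) auto
  have "act X (n - 2) (n - 1) (coface (n - 1) i) (face X n j x) = act X (n - 2) n ?\<beta> x"
    using assms by (intro act_face[OF assms(1)] c b) (auto simp: compose_def coface_def)
  moreover have "act X (n - 2) (n - 1) (coface (n - 1) (j - 1)) (face X n i x) = act X (n - 2) n ?\<beta> x"
    using assms by (intro act_face[OF assms(1)] c b) (auto simp: compose_def coface_def)
  ultimately show ?thesis unfolding face_def by (simp add: numeral_2_eq_2)
qed

lemma map_face: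
  assumes "semisimplicial_map X Y p" "1 \<le> n" "i \<le> n" "x \<in> simplices X n"
  shows "p (n - 1) (face X n i x) = face Y n i (p n x)"
  using assms coface_in_inj_maps[OF assms(2,3)] unfolding semisimplicial_map_def face_def by auto

section \<open>Horns given by compatible faces\<close>

text \<open>
  The factorisation of a map that misses \<open>j\<close> through the \<open>j\<close>-th coface.
\<close>

definition squeeze :: "nat \<Rightarrow> nat \<Rightarrow> (nat \<Rightarrow> nat) \<Rightarrow> nat \<Rightarrow> nat" where
  "squeeze m j \<alpha> = (\<lambda>k\<in>{..m}. if \<alpha> k < j then \<alpha> k else \<alpha> k - 1)"

lemma squeeze_in_inj_maps:
  assumes "\<alpha> \<in> inj_maps m n" "j \<notin> \<alpha> ` {..m}" "1 \<le> n" "j \<le> n"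
  shows "squeeze m j \<alpha> \<in> inj_maps m (n - 1)"
proof -
  have 1: "\<alpha> k \<le> n" "\<alpha> k \<noteq> j" if "k \<le> m" for k
    using assms that by (auto simp: inj_maps_def)
  have 2: "\<alpha> k < \<alpha> l" if "k < l" "l \<le> m" for k l
    using assms that by (auto simp: inj_maps_def strict_mono_on_def)
  have "squeeze m j \<alpha> k \<le> n - 1" if "k \<le> m" for k
    using 1[OF that] assms that by (auto simp: squeeze_def)
  moreover have "squeeze m j \<alpha> k < squeeze m j \<alpha> l" if "k < l" "l \<le> m" for k l
    using 1[of k] 1[of l] 2[OF that] that by (auto simp: squeeze_def)
  ultimately show ?thesis
    by (auto simp: inj_maps_def strict_mono_on_def squeeze_def PiE_def)
qed

lemma squeeze_image:
  assumes "k \<le> m" "j \<notin> \<alpha> ` {..m}"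
  shows "\<alpha> k = (if squeeze m j \<alpha> k < j then squeeze m j \<alpha> k else Suc (squeeze m j \<alpha> k))"
proof -
  have "\<alpha> k \<noteq> j" using assms by auto
  then show ?thesis using assms(1) by (auto simp: squeeze_def)
qed

text \<open>
  A map that misses two vertices factors through both faces, and then through their intersection,
  where the given simplices agree; so the value of the horn does not depend on the chosen face.
\<close>

lemma horn_faces_agree:
  assumes X: "semisimplicial_set X" and n: "2 \<le> n"
    and x: "\<And>c. \<lbrakk>c \<le> n; c \<noteq> i\<rbrakk> \<Longrightarrow> x c \<in> simplices X (n - 1)"
    and compat: "\<And>c c'. \<lbrakk>c < c'; c' \<le> n; c \<noteq> i; c' \<noteq> i\<rbrakk>
      \<Longrightarrow> face X (n - 1) c (x c') = face X (n - 1) (c' - 1) (x c)"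
    and \<alpha>: "\<alpha> \<in> inj_maps m n"
    and j: "j \<le> n" "j \<noteq> i" "j \<notin> \<alpha> ` {..m}" and j': "j' \<le> n" "j' \<noteq> i" "j' \<notin> \<alpha> ` {..m}"
  shows "act X m (n - 1) (squeeze m j \<alpha>) (x j) = act X m (n - 1) (squeeze m j' \<alpha>) (x j')"
proof -
  have main: "act X m (n - 1) (squeeze m j' \<alpha>) (x j') = act X m (n - 1) (squeeze m j \<alpha>) (x j)"
    if jj: "j < j'" and j: "j \<le> n" "j \<noteq> i" "j \<notin> \<alpha> ` {..m}" and j': "j' \<le> n" "j' \<noteq> i" "j' \<notin> \<alpha> ` {..m}"
    for j j'
  proof -
    let ?a = "squeeze m j' \<alpha>"
    have a: "?a \<in> inj_maps m (n - 1)" using squeeze_in_inj_maps[OF \<alpha> j'(3)] n j' by simp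
    have b: "squeeze m j \<alpha> \<in> inj_maps m (n - 1)" using squeeze_in_inj_maps[OF \<alpha> j(3)] n j by simp
    have jm: "j \<notin> ?a ` {..m}"
    proof
      assume "j \<in> ?a ` {..m}"
      then obtain k where k: "k \<le> m" "j = ?a k" by auto
      have "\<alpha> k = j" using squeeze_image[OF k(1) j'(3)] k jj by auto
      then show False using k(1) j(3) by auto
    qed
    let ?g = "squeeze m j ?a"
    have g: "?g \<in> inj_maps m (n - 1 - 1)" using squeeze_in_inj_maps[OF a jm] n j j' jj by simp
    have "act X m (n - 1 - 1) ?g (face X (n - 1) j (x j')) = act X m (n - 1) ?a (x j')"
      using n jj j' x[OF j'(1,2)] squeeze_image[OF _ jm] by (intro act_face[OF X _ _ _ g a]) auto
    moreover have "act X m (n - 1 - 1) ?g (face X (n - 1) (j' - 1) (x j)) = act X m (n - 1) (squeeze m j \<alpha>) (x j)"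
    proof (intro act_face[OF X _ _ _ g b])
      fix k assume k: "k \<le> m"
      then have "\<alpha> k \<noteq> j" "\<alpha> k \<noteq> j'" using j j' by auto
      then show "squeeze m j \<alpha> k = (if ?g k < j' - 1 then ?g k else Suc (?g k))"
        using k jj by (auto simp: squeeze_def)
    qed (use n j' x[OF j(1,2)] in auto)
    moreover have "face X (n - 1) j (x j') = face X (n - 1) (j' - 1) (x j)"
      using compat[OF jj] j j' by auto
    ultimately show ?thesis by simp
  qed
  show ?thesis
    using main[OF _ j j'] main[OF _ j' j] by (cases j j' rule: linorder_cases) auto
qed

definition horn_map :: "'a semisimplicial \<Rightarrow> nat \<Rightarrow> nat \<Rightarrow> (nat \<Rightarrow> 'a) \<Rightarrow> nat \<Rightarrow> (nat \<Rightarrow> nat) \<Rightarrow> 'a" where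
  "horn_map X n i x m \<alpha> =
     (let j = (SOME j. j \<le> n \<and> j \<noteq> i \<and> j \<notin> \<alpha> ` {..m}) in act X m (n - 1) (squeeze m j \<alpha>) (x j))"

lemma horn_simplices:
  "simplices (horn n i) m = {\<alpha> \<in> inj_maps m n. \<exists>j\<le>n. j \<noteq> i \<and> j \<notin> \<alpha> ` {..m}}"
  by (auto simp: horn_def)

text \<open>
  The passage from families of matching faces to maps out of the horn. Maps \<open>\<Delta>\<^sup>n \<rightarrow> Y\<close> are
  \<open>n\<close>-simplices of \<open>Y\<close> by the Yoneda lemma.
\<close>

lemma horn_square_from_faces:
  assumes X: "semisimplicial_set X" and Y: "semisimplicial_set Y" and p: "semisimplicial_map X Y p"
    and n: "2 \<le> n"
    and x: "\<And>c. \<lbrakk>c \<le> n; c \<noteq> i\<rbrakk> \<Longrightarrow> x c \<in> simplices X (n - 1)"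
    and compat: "\<And>c c'. \<lbrakk>c < c'; c' \<le> n; c \<noteq> i; c' \<noteq> i\<rbrakk>
      \<Longrightarrow> face X (n - 1) c (x c') = face X (n - 1) (c' - 1) (x c)"
    and y: "y \<in> simplices Y n" and px: "\<And>c. \<lbrakk>c \<le> n; c \<noteq> i\<rbrakk> \<Longrightarrow> p (n - 1) (x c) = face Y n c y"
  shows "horn_square X Y p n i (horn_map X n i x) (\<lambda>m \<alpha>. act Y m n \<alpha> y)"
    and "\<And>m \<alpha> j. \<lbrakk>\<alpha> \<in> inj_maps m n; j \<le> n; j \<noteq> i; j \<notin> \<alpha> ` {..m}\<rbrakk>
      \<Longrightarrow> horn_map X n i x m \<alpha> = act X m (n - 1) (squeeze m j \<alpha>) (x j)"
proof -
  let ?h = "horn_map X n i x"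
  show h: "?h m \<alpha> = act X m (n - 1) (squeeze m j \<alpha>) (x j)"
    if "\<alpha> \<in> inj_maps m n" "j \<le> n" "j \<noteq> i" "j \<notin> \<alpha> ` {..m}" for m \<alpha> j
  proof -
    let ?P = "\<lambda>j. j \<le> n \<and> j \<noteq> i \<and> j \<notin> \<alpha> ` {..m}"
    have "?P (SOME j. ?P j)" using that by (intro someI[of ?P j]) auto
    then show ?thesis
      unfolding horn_map_def Let_def
      by (intro horn_faces_agree[OF X n, of i x, OF x compat that(1)]) (use that in auto)
  qed
  have sq: "squeeze m j \<alpha> \<in> inj_maps m (n - 1)" if "\<alpha> \<in> inj_maps m n" "j \<le> n" "j \<notin> \<alpha> ` {..m}" for m j \<alpha>
    using squeeze_in_inj_maps[OF that(1,3)] that n by simp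
  have "semisimplicial_map (horn n i) X ?h"
    unfolding semisimplicial_map_def
  proof (intro conjI allI ballI funcsetI)
    fix m \<alpha> assume "\<alpha> \<in> simplices (horn n i) m"
    then obtain j where j: "\<alpha> \<in> inj_maps m n" "j \<le> n" "j \<noteq> i" "j \<notin> \<alpha> ` {..m}" by (auto simp: horn_simplices)
    show "?h m \<alpha> \<in> simplices X m"
      using h[OF j] semisimplicial_setD(1)[OF X sq[OF j(1,2,4)] x[OF j(2,3)]] by simp
  next
    fix l m \<beta> \<alpha> assume b: "\<beta> \<in> inj_maps l m" and "\<alpha> \<in> simplices (horn n i) m"
    then obtain j where j: "\<alpha> \<in> inj_maps m n" "j \<le> n" "j \<noteq> i" "j \<notin> \<alpha> ` {..m}" by (auto simp: horn_simplices)
    let ?c = "compose {..l} \<alpha> \<beta>"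
    have bl: "\<And>k. k \<le> l \<Longrightarrow> \<beta> k \<le> m" using b by (auto simp: inj_maps_def)
    have c: "?c \<in> inj_maps l n" using compose_in_inj_maps[OF b j(1)] .
    have jc: "j \<notin> ?c ` {..l}" using j(4) bl by (auto simp: compose_def)
    have "squeeze l j ?c = compose {..l} (squeeze m j \<alpha>) \<beta>"
      using bl by (auto simp: squeeze_def compose_def restrict_def fun_eq_iff)
    then have "?h l ?c = act X l m \<beta> (?h m \<alpha>)"
      using h[OF c j(2,3) jc] h[OF j] semisimplicial_setD(3)[OF X b sq[OF j(1,2,4)] x[OF j(2,3)]] by simp
    then show "?h l (act (horn n i) l m \<beta> \<alpha>) = act X l m \<beta> (?h m \<alpha>)"
      by (simp add: horn_def std_simplex_def)
  qed
  moreover have "semisimplicial_map (std_simplex n) Y (\<lambda>m \<alpha>. act Y m n \<alpha> y)"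
    unfolding semisimplicial_map_def std_simplex_def
    using semisimplicial_setD[OF Y] y by auto
  moreover have "p m (?h m \<alpha>) = act Y m n \<alpha> y" if "\<alpha> \<in> simplices (horn n i) m" for m \<alpha>
  proof -
    obtain j where j: "\<alpha> \<in> inj_maps m n" "j \<le> n" "j \<noteq> i" "j \<notin> \<alpha> ` {..m}"
      using \<open>\<alpha> \<in> simplices (horn n i) m\<close> by (auto simp: horn_simplices)
    have "p m (?h m \<alpha>) = act Y m (n - 1) (squeeze m j \<alpha>) (face Y n j y)"
      using p sq[OF j(1,2,4)] x[OF j(2,3)] px[OF j(2,3)] h[OF j] by (simp add: semisimplicial_map_def)
    also have "\<dots> = act Y m n \<alpha> y"
      using squeeze_image[OF _ j(4)] n j by (intro act_face[OF Y _ _ y sq[OF j(1,2,4)] j(1)]) auto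
    finally show ?thesis .
  qed
  ultimately show "horn_square X Y p n i ?h (\<lambda>m \<alpha>. act Y m n \<alpha> y)"
    unfolding horn_square_def by blast
qed

text \<open>
  The edges that must be cocartesian, respectively cartesian, to fill an outer horn.
\<close>

definition first_edge :: "'a semisimplicial \<Rightarrow> nat \<Rightarrow> 'a \<Rightarrow> 'a" where
  "first_edge X n = act X 1 n (edge 0 1)"

definition last_edge :: "'a semisimplicial \<Rightarrow> nat \<Rightarrow> 'a \<Rightarrow> 'a" where
  "last_edge X n = act X 1 n (edge (n - 1) n)"

lemma edge_01: "edge 0 1 = (\<lambda>k\<in>{..1}. k)"
  by (auto simp: edge_def fun_eq_iff)

lemma first_edge_1: "\<lbrakk>semisimplicial_set X; x \<in> simplices X 1\<rbrakk> \<Longrightarrow> first_edge X 1 x = x"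
  by (simp only: first_edge_def edge_01 semisimplicial_setD(2))

lemma last_edge_1: "\<lbrakk>semisimplicial_set X; x \<in> simplices X 1\<rbrakk> \<Longrightarrow> last_edge X 1 x = x"
  using first_edge_1[of X x] by (simp add: first_edge_def last_edge_def)

lemma first_edge_face:
  assumes "semisimplicial_set X" "2 \<le> n" "x \<in> simplices X n"
  shows "first_edge X n x = first_edge X (n - 1) (face X n n x)"
  unfolding first_edge_def using assms
  by (intro act_face[symmetric] edge_in_inj_maps) (auto simp: edge_def)

lemma last_edge_face:
  assumes "semisimplicial_set X" "2 \<le> n" "x \<in> simplices X n"
  shows "last_edge X n x = last_edge X (n - 1) (face X n 0 x)"
  unfolding last_edge_def using assms
  by (intro act_face[symmetric] edge_in_inj_maps) (auto simp: edge_def)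

lemma filler_from_lift:
  assumes X: "semisimplicial_set X" and Y: "semisimplicial_set Y" and p: "semisimplicial_map X Y p"
    and n: "2 \<le> n"
    and x: "\<And>c. \<lbrakk>c \<le> n; c \<noteq> i\<rbrakk> \<Longrightarrow> x c \<in> simplices X (n - 1)"
    and compat: "\<And>c c'. \<lbrakk>c < c'; c' \<le> n; c \<noteq> i; c' \<noteq> i\<rbrakk>
      \<Longrightarrow> face X (n - 1) c (x c') = face X (n - 1) (c' - 1) (x c)"
    and y: "y \<in> simplices Y n" and px: "\<And>c. \<lbrakk>c \<le> n; c \<noteq> i\<rbrakk> \<Longrightarrow> p (n - 1) (x c) = face Y n c y"
    and lift: "diagonal_lift X Y p n i (horn_map X n i x) (\<lambda>m \<alpha>. act Y m n \<alpha> y) l"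
  shows "\<exists>w\<in>simplices X n. p n w = y \<and> (\<forall>c\<le>n. c \<noteq> i \<longrightarrow> face X n c w = x c)"
proof
  let ?id = "\<lambda>k\<in>{..n}. k"
  have id: "?id \<in> inj_maps n n" by (rule identity_in_inj_maps)
  have l: "semisimplicial_map (std_simplex n) X l" using lift by (simp add: diagonal_lift_def)
  show "l n ?id \<in> simplices X n"
    using l id unfolding semisimplicial_map_def std_simplex_def by fastforce
  show "p n (l n ?id) = y \<and> (\<forall>c\<le>n. c \<noteq> i \<longrightarrow> face X n c (l n ?id) = x c)"
  proof (intro conjI allI impI)
    have "p n (l n ?id) = act Y n n ?id y"
      using lift id unfolding diagonal_lift_def std_simplex_def by auto
    then show "p n (l n ?id) = y" using semisimplicial_setD(2)[OF Y y] by simp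
    fix c assume c: "c \<le> n" "c \<noteq> i"
    have cf: "coface n c \<in> inj_maps (n - 1) n" using coface_in_inj_maps n c by simp
    have cm: "c \<notin> coface n c ` {..n - 1}" by (auto simp: coface_def)
    have "compose {..n - 1} ?id (coface n c) = coface n c"
    proof (rule inj_maps_eqI[OF compose_in_inj_maps[OF cf id] cf])
      fix k assume "k \<le> n - 1"
      then show "compose {..n - 1} ?id (coface n c) k = coface n c k"
        using cf by (auto simp: compose_def inj_maps_def)
    qed
    moreover have "l (n - 1) (act (std_simplex n) (n - 1) n (coface n c) ?id) = face X n c (l n ?id)"
      using l cf id unfolding semisimplicial_map_def face_def by (simp add: std_simplex_def)
    ultimately have "face X n c (l n ?id) = l (n - 1) (coface n c)"
      by (simp add: std_simplex_def)
    also have "\<dots> = horn_map X n i x (n - 1) (coface n c)"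
      using lift cf cm c unfolding diagonal_lift_def horn_simplices by blast
    also have "\<dots> = act X (n - 1) (n - 1) (squeeze (n - 1) c (coface n c)) (x c)"
      using horn_square_from_faces(2)[OF X Y p n x compat y px cf c cm] .
    also have "squeeze (n - 1) c (coface n c) = (\<lambda>k\<in>{..n - 1}. k)"
      by (auto simp: squeeze_def coface_def fun_eq_iff)
    also have "act X (n - 1) (n - 1) (\<lambda>k\<in>{..n - 1}. k) (x c) = x c"
      by (rule semisimplicial_setD(2)[OF X x[OF c]])
    finally show "face X n c (l n ?id) = x c" .
  qed
qed

text \<open>
  The three lifting hypotheses in terms of faces; everything below uses them only in this form. The
  first edge of a horn that lacks face \<open>0\<close> is found in its last face, and dually.
\<close>

lemma horn_filler:
  assumes X: "semisimplicial_set X" and Y: "semisimplicial_set Y" and p: "inner_fibration X Y p"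
    and n: "2 \<le> n" and i: "i \<le> n"
    and x: "\<And>c. \<lbrakk>c \<le> n; c \<noteq> i\<rbrakk> \<Longrightarrow> x c \<in> simplices X (n - 1)"
    and compat: "\<And>c c'. \<lbrakk>c < c'; c' \<le> n; c \<noteq> i; c' \<noteq> i\<rbrakk>
      \<Longrightarrow> face X (n - 1) c (x c') = face X (n - 1) (c' - 1) (x c)"
    and y: "y \<in> simplices Y n" and px: "\<And>c. \<lbrakk>c \<le> n; c \<noteq> i\<rbrakk> \<Longrightarrow> p (n - 1) (x c) = face Y n c y"
    and first: "i = 0 \<Longrightarrow> cocartesian X Y p (first_edge X (n - 1) (x n))"
    and last: "i = n \<Longrightarrow> cartesian X Y p (last_edge X (n - 1) (x 0))"
  shows "\<exists>w\<in>simplices X n. p n w = y \<and> (\<forall>c\<le>n. c \<noteq> i \<longrightarrow> face X n c w = x c)"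
proof -
  have ps: "semisimplicial_map X Y p" using p by (simp add: inner_fibration_def)
  let ?h = "horn_map X n i x" and ?k = "\<lambda>m \<alpha>. act Y m n \<alpha> y"
  note sq = horn_square_from_faces[OF X Y ps n x compat y px]
  have "\<exists>l. diagonal_lift X Y p n i ?h ?k l"
  proof -
    consider "i = 0" | "i = n" | "0 < i" "i < n" using i by linarith
    then show ?thesis
    proof cases
      case 1
      have "?h 1 (edge 0 1) = act X 1 (n - 1) (squeeze 1 n (edge 0 1)) (x n)"
        using 1 n by (intro sq(2) edge_in_inj_maps) (auto simp: edge_def)
      also have "squeeze 1 n (edge 0 1) = edge 0 1"
        using n by (auto simp: squeeze_def edge_def fun_eq_iff)
      finally have "?h 1 (edge 0 1) = first_edge X (n - 1) (x n)" by (simp add: first_edge_def)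
      then show ?thesis
        using first[OF 1] sq(1) n 1 unfolding cocartesian_def by blast
    next
      case 2
      have "?h 1 (edge (n - 1) n) = act X 1 (n - 1) (squeeze 1 0 (edge (n - 1) n)) (x 0)"
        using 2 n by (intro sq(2) edge_in_inj_maps) (auto simp: edge_def)
      also have "squeeze 1 0 (edge (n - 1) n) = edge (n - 1 - 1) (n - 1)"
        using n by (auto simp: squeeze_def edge_def fun_eq_iff)
      finally have "?h 1 (edge (n - 1) n) = last_edge X (n - 1) (x 0)" by (simp add: last_edge_def)
      then show ?thesis
        using last[OF 2] sq(1) n 2 unfolding cartesian_def by blast
    next
      case 3
      then show ?thesis using p sq(1) unfolding inner_fibration_def by blast
    qed
  qed
  then obtain l where "diagonal_lift X Y p n i ?h ?k l" ..
  from filler_from_lift[OF X Y ps n x compat y px this] show ?thesis .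
qed

section \<open>Sorted vertex lists\<close>

text \<open>
  The list \<open>l\<close> stands for the map \<open>i \<mapsto> l ! i\<close>; then \<open>del j\<close> is composition with the \<open>j\<close>-th coface and
  \<open>dup j\<close> is composition with the \<open>j\<close>-th codegeneracy. The lemmas on \<open>del\<close> and \<open>dup\<close> are the
  cosimplicial identities.
\<close>

definition del :: "nat \<Rightarrow> nat list \<Rightarrow> nat list" where
  "del j l = take j l @ drop (Suc j) l"

definition dup :: "nat \<Rightarrow> nat list \<Rightarrow> nat list" where
  "dup j l = take (Suc j) l @ drop j l"

definition repeats_at :: "nat list \<Rightarrow> nat \<Rightarrow> bool" where
  "repeats_at l i \<longleftrightarrow> Suc i < length l \<and> l ! i = l ! Suc i"

lemma length_del [simp]: "j < length l \<Longrightarrow> length (del j l) = length l - 1"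
  by (simp add: del_def)

lemma length_dup [simp]: "j < length l \<Longrightarrow> length (dup j l) = Suc (length l)"
  by (simp add: dup_def)

lemma nth_del: "\<lbrakk>j < length l; k < length l - 1\<rbrakk> \<Longrightarrow> del j l ! k = (if k < j then l ! k else l ! Suc k)"
  by (auto simp: del_def nth_append min_def)

lemma nth_dup: "\<lbrakk>j < length l; k \<le> length l\<rbrakk> \<Longrightarrow> dup j l ! k = (if k \<le> j then l ! k else l ! (k - 1))"
  by (auto simp: dup_def nth_append min_def not_le less_Suc_eq_le intro!: arg_cong[of _ _ "(!) l"])

lemma del_del: "\<lbrakk>i < j; j < length l\<rbrakk> \<Longrightarrow> del i (del j l) = del (j - 1) (del i l)"
  by (rule nth_equalityI) (auto simp: nth_del)

lemma del_dup_less: "\<lbrakk>i < j; j < length l\<rbrakk> \<Longrightarrow> del i (dup j l) = dup (j - 1) (del i l)"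
  by (rule nth_equalityI) (auto simp: nth_del nth_dup)

lemma del_dup_same: "j < length l \<Longrightarrow> del j (dup j l) = l"
  by (rule nth_equalityI) (auto simp: nth_del nth_dup)

lemma del_Suc_dup_same: "j < length l \<Longrightarrow> del (Suc j) (dup j l) = l"
  by (rule nth_equalityI) (auto simp: nth_del nth_dup)

lemma del_dup_greater: "\<lbrakk>Suc j < i; i \<le> length l\<rbrakk> \<Longrightarrow> del i (dup j l) = dup j (del (i - 1) l)"
  by (rule nth_equalityI) (auto simp: nth_del nth_dup)

lemma dup_dup: "\<lbrakk>i \<le> j; j < length l\<rbrakk> \<Longrightarrow> dup i (dup j l) = dup (Suc j) (dup i l)"
  by (rule nth_equalityI) (auto simp: nth_dup)

lemma repeats_at_dup: "j < length l \<Longrightarrow> repeats_at (dup j l) j"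
  by (auto simp: repeats_at_def nth_dup)

lemma dup_del: "repeats_at l i \<Longrightarrow> dup i (del i l) = l"
  by (rule nth_equalityI) (auto simp: nth_dup nth_del repeats_at_def le_less_Suc_eq not_less le_Suc_eq)

lemma del_Suc: "repeats_at l i \<Longrightarrow> del (Suc i) l = del i l"
  using del_Suc_dup_same[of i "del i l"] dup_del[of l i] by (auto simp: repeats_at_def)

lemma set_dup [simp]: "j < length l \<Longrightarrow> set (dup j l) = set l"
proof -
  assume j: "j < length l"
  have "set (dup j l) = set (take j l) \<union> set (drop j l)"
    using j by (auto simp: dup_def take_Suc_conv_app_nth Cons_nth_drop_Suc[symmetric])
  then show ?thesis by (metis append_take_drop_id set_append)
qed

lemma set_del_subset: "set (del j l) \<subseteq> set l"
  by (auto simp: del_def dest: in_set_takeD in_set_dropD)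

lemma set_del: "repeats_at l j \<Longrightarrow> set (del j l) = set l"
  using set_dup[of j "del j l"] dup_del[of l j] by (auto simp: repeats_at_def)

lemma sorted_del: "sorted l \<Longrightarrow> j < length l \<Longrightarrow> sorted (del j l)"
  unfolding sorted_iff_nth_mono by (auto simp: nth_del)

lemma sorted_dup: "sorted l \<Longrightarrow> j < length l \<Longrightarrow> sorted (dup j l)"
  unfolding sorted_iff_nth_mono by (auto simp: nth_dup)

definition vertex_lists :: "nat \<Rightarrow> nat list set" where
  "vertex_lists m = {l. sorted l \<and> set l \<subseteq> {..m} \<and> l \<noteq> []}"

lemma dup_in_vertex_lists: "\<lbrakk>l \<in> vertex_lists m; j < length l\<rbrakk> \<Longrightarrow> dup j l \<in> vertex_lists m"
  using length_dup[of j l] by (auto simp: vertex_lists_def sorted_dup simp del: length_dup)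

lemma del_in_vertex_lists:
  "\<lbrakk>l \<in> vertex_lists m; j < length l; 2 \<le> length l\<rbrakk> \<Longrightarrow> del j l \<in> vertex_lists m"
  using length_del[of j l] set_del_subset[of j l]
  by (auto simp: vertex_lists_def sorted_del simp del: length_del)

lemma nonrepeating_strict:
  assumes "sorted l" "\<nexists>i. repeats_at l i" "i < j" "j < length l"
  shows "l ! i < l ! j"
proof -
  have "l ! i \<le> l ! Suc i" "l ! i \<noteq> l ! Suc i" "l ! Suc i \<le> l ! j"
    using assms by (auto simp: repeats_at_def sorted_iff_nth_mono)
  then show ?thesis by linarith
qed

lemma del_nonrepeating:
  assumes "sorted l" "\<nexists>i. repeats_at l i" "j < length l"
  shows "\<nexists>i. repeats_at (del j l) i"
proof
  assume "\<exists>i. repeats_at (del j l) i"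
  then obtain i where i: "Suc (Suc i) < length l" "del j l ! i = del j l ! Suc i"
    using assms(3) less_diff_conv by (auto simp: repeats_at_def)
  then show False
    using nonrepeating_strict[OF assms(1,2), of i "Suc i"] nonrepeating_strict[OF assms(1,2), of i "Suc (Suc i)"]
      nonrepeating_strict[OF assms(1,2), of "Suc i" "Suc (Suc i)"] assms(3)
    by (auto simp: nth_del split: if_splits)
qed

section \<open>Simplicial subsets and the action of weakly monotone maps\<close>

definition simplicial_subset :: "'a semisimplicial \<Rightarrow> (nat \<Rightarrow> 'a set) \<Rightarrow> (nat \<Rightarrow> nat \<Rightarrow> 'a \<Rightarrow> 'a) \<Rightarrow> bool" where
  "simplicial_subset X B s \<longleftrightarrow> (\<forall>n. B n \<subseteq> simplices X n) \<and>
     (\<forall>n i. 1 \<le> n \<longrightarrow> i \<le> n \<longrightarrow> face X n i ` B n \<subseteq> B (n - 1)) \<and>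
     simplicial_structure (X\<lparr>simplices := B\<rparr>) s"

lemma face_simplices_update [simp]: "face (X\<lparr>simplices := B\<rparr>) n i = face X n i"
  by (simp add: face_def)

lemma simplicial_subsetD:
  assumes "simplicial_subset X B s"
  shows "\<And>n x. x \<in> B n \<Longrightarrow> x \<in> simplices X n"
    and "\<And>n i x. \<lbrakk>1 \<le> n; i \<le> n; x \<in> B n\<rbrakk> \<Longrightarrow> face X n i x \<in> B (n - 1)"
    and "\<And>n i x. \<lbrakk>i \<le> n; x \<in> B n\<rbrakk> \<Longrightarrow> s n i x \<in> B (Suc n)"
    and "\<And>n i j x. \<lbrakk>i < j; j \<le> n; x \<in> B n\<rbrakk> \<Longrightarrow> face X (Suc n) i (s n j x) = s (n - 1) (j - 1) (face X n i x)"
    and "\<And>n j x. \<lbrakk>j \<le> n; x \<in> B n\<rbrakk> \<Longrightarrow> face X (Suc n) j (s n j x) = x"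
    and "\<And>n j x. \<lbrakk>j \<le> n; x \<in> B n\<rbrakk> \<Longrightarrow> face X (Suc n) (Suc j) (s n j x) = x"
    and "\<And>n i j x. \<lbrakk>Suc j < i; i \<le> Suc n; x \<in> B n\<rbrakk> \<Longrightarrow> face X (Suc n) i (s n j x) = s (n - 1) j (face X n (i - 1) x)"
    and "\<And>n i j x. \<lbrakk>i \<le> j; j \<le> n; x \<in> B n\<rbrakk> \<Longrightarrow> s (Suc n) i (s n j x) = s (Suc n) (Suc j) (s n i x)"
  using assms unfolding simplicial_subset_def simplicial_structure_def face_simplices_update
  by (simp_all add: Pi_iff subset_eq)

text \<open>
  The action of a weakly monotone map on \<open>y\<close>, for \<open>y\<close> of dimension \<open>m\<close>: an injective map acts by the
  given structure, and otherwise the first repeated vertex is split off as a degeneracy. If the list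
  misses a vertex, then \<open>s\<close> is applied only to degeneracies of proper faces of \<open>y\<close>; so this makes sense for
  a simplex \<open>y\<close> that has no degeneracies yet.
\<close>

function degen_act ::
  "'a semisimplicial \<Rightarrow> (nat \<Rightarrow> nat \<Rightarrow> 'a \<Rightarrow> 'a) \<Rightarrow> nat \<Rightarrow> 'a \<Rightarrow> nat list \<Rightarrow> 'a" where
  "degen_act X s m y l =
     (if \<exists>i. repeats_at l i
      then let i = (LEAST i. repeats_at l i) in s (length l - 2) i (degen_act X s m y (del i l))
      else act X (length l - 1) m (\<lambda>k\<in>{..length l - 1}. l ! k) y)"
  by pat_completeness auto
termination
proof (relation "measure (\<lambda>(X, s, m, y, l). length l)")
  fix X :: "'a semisimplicial" and s m y and l :: "nat list" and i
  assume "\<exists>i. repeats_at l i" "i = (LEAST i. repeats_at l i)"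
  then have "repeats_at l i" by (simp add: LeastI_ex)
  then show "((X, s, m, y, del i l), (X, s, m, y, l)) \<in> measure (\<lambda>(X, s, m, y, l). length l)"
    by (auto simp: repeats_at_def)
qed auto

declare degen_act.simps [simp del]

lemma degen_act_nonrepeating:
  "\<nexists>i. repeats_at l i \<Longrightarrow>
    degen_act X s m y l = act X (length l - 1) m (\<lambda>k\<in>{..length l - 1}. l ! k) y"
  by (subst degen_act.simps) metis

lemma degen_act_repeating:
  assumes "repeats_at l i" "\<And>k. k < i \<Longrightarrow> \<not> repeats_at l k"
  shows "degen_act X s m y l = s (length l - 2) i (degen_act X s m y (del i l))"
proof -
  have "(LEAST i. repeats_at l i) = i"
    using assms by (intro Least_equality) (auto simp: not_less[symmetric])
  then show ?thesis using assms(1) by (subst degen_act.simps) (auto simp: Let_def)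
qed

lemma first_repetition:
  assumes "repeats_at l j"
  obtains i where "i \<le> j" "repeats_at l i" "\<And>k. k < i \<Longrightarrow> \<not> repeats_at l k"
  using assms by (metis LeastI Least_le not_less_Least)

lemma nth_in_inj_maps:
  assumes "l \<in> vertex_lists m" "\<nexists>i. repeats_at l i"
  shows "(\<lambda>k\<in>{..length l - 1}. l ! k) \<in> inj_maps (length l - 1) m"
proof -
  have "k < length l" if "k \<le> length l - 1" for k
    using assms(1) that by (cases l) (auto simp: vertex_lists_def)
  then show ?thesis
    using assms nonrepeating_strict[of l]
    by (auto simp: inj_maps_def strict_mono_on_def vertex_lists_def subset_eq)
qed

lemma face_degen_act_nonrepeating:
  assumes X: "semisimplicial_set X" and y: "y \<in> simplices X m"
    and l: "l \<in> vertex_lists m" "\<nexists>i. repeats_at l i" and j: "j < length l" "2 \<le> length l"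
  shows "face X (length l - 1) j (degen_act X s m y l) = degen_act X s m y (del j l)"
proof -
  let ?n = "length l - 1"
  have dl: "del j l \<in> vertex_lists m" "\<nexists>i. repeats_at (del j l) i"
    using del_in_vertex_lists l j del_nonrepeating[OF _ l(2)] by (auto simp: vertex_lists_def)
  have cf: "coface ?n j \<in> inj_maps (?n - 1) ?n" using j by (intro coface_in_inj_maps) auto
  have "compose {..?n - 1} (\<lambda>k\<in>{..?n}. l ! k) (coface ?n j) = (\<lambda>k\<in>{..?n - 1}. del j l ! k)"
    using j by (auto simp: compose_def coface_def fun_eq_iff nth_del)
  then show ?thesis
    using semisimplicial_setD(3)[OF X cf nth_in_inj_maps[OF l] y] j
    by (simp add: degen_act_nonrepeating l dl face_def)
qed

text \<open>
  If \<open>V\<close> is a proper set of vertices, then this can hold although \<open>y\<close> is not in \<open>B\<close>, and it confines the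
  action of lists with entries in \<open>V\<close> to \<open>B\<close>.
\<close>

definition faces_in ::
  "'a semisimplicial \<Rightarrow> (nat \<Rightarrow> 'a set) \<Rightarrow> (nat \<Rightarrow> nat \<Rightarrow> 'a \<Rightarrow> 'a) \<Rightarrow> nat \<Rightarrow> 'a \<Rightarrow> nat set \<Rightarrow> bool" where
  "faces_in X B s m y V \<longleftrightarrow>
     (\<forall>l\<in>vertex_lists m. set l \<subseteq> V \<longrightarrow> (\<nexists>i. repeats_at l i) \<longrightarrow> degen_act X s m y l \<in> B (length l - 1))"

context
  fixes X :: "'a semisimplicial" and B s m y V
  assumes B: "simplicial_subset X B s" and V: "faces_in X B s m y V"
begin

lemma degen_act_in_subset:
  "\<lbrakk>l \<in> vertex_lists m; set l \<subseteq> V\<rbrakk> \<Longrightarrow> degen_act X s m y l \<in> B (length l - 1)"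
proof (induction "length l" arbitrary: l rule: less_induct)
  case less
  show ?case
  proof (cases "\<exists>i. repeats_at l i")
    case True
    then obtain i where i: "repeats_at l i" "\<And>k. k < i \<Longrightarrow> \<not> repeats_at l k"
      using first_repetition by metis
    then have len: "Suc i < length l" by (simp add: repeats_at_def)
    have "degen_act X s m y (del i l) \<in> B (length l - 2)"
      using less(1)[of "del i l"] less(2,3) del_in_vertex_lists[of l m i] set_del_subset[of i l] len
      by (auto simp: numeral_2_eq_2)
    then have "s (length l - 2) i (degen_act X s m y (del i l)) \<in> B (Suc (length l - 2))"
      using len by (intro simplicial_subsetD(3)[OF B]) auto
    moreover have "Suc (length l - 2) = length l - 1" using len by simp
    ultimately show ?thesis using degen_act_repeating[OF i, of X s m y] by simp
  qed (use V less in \<open>auto simp: faces_in_def\<close>)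
qed

text \<open>
  If the first repetition of \<open>dup j l\<close> is not at \<open>j\<close>, then it is one of \<open>l\<close>, and the two degeneracies
  commute by the identity \<open>s\<^sub>i s\<^sub>j = s\<^sub>j\<^sub>+\<^sub>1 s\<^sub>i\<close>.
\<close>

lemma degeneracy_degen_act:
  "\<lbrakk>l \<in> vertex_lists m; set l \<subseteq> V; j < length l\<rbrakk>
    \<Longrightarrow> s (length l - 1) j (degen_act X s m y l) = degen_act X s m y (dup j l)"
proof (induction "length l" arbitrary: l j rule: less_induct)
  case less
  obtain i where i: "i \<le> j" "repeats_at (dup j l) i" "\<And>k. k < i \<Longrightarrow> \<not> repeats_at (dup j l) k"
    using first_repetition[OF repeats_at_dup[OF less(4)]] by metis
  have d: "degen_act X s m y (dup j l) = s (length l - 1) i (degen_act X s m y (del i (dup j l)))"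
    using degen_act_repeating[OF i(2,3)] less(4) by simp
  show ?case
  proof (cases "i = j")
    case True
    then show ?thesis using d del_dup_same[OF less(4)] by simp
  next
    case False
    then have ij: "i < j" using i(1) by simp
    have rl: "repeats_at l k \<longleftrightarrow> repeats_at (dup j l) k" if "k < j" for k
      using that less(4) by (auto simp: repeats_at_def nth_dup)
    have ri: "repeats_at l i" "\<And>k. k < i \<Longrightarrow> \<not> repeats_at l k" using rl ij i by auto
    let ?n = "length l - 2" and ?z = "degen_act X s m y (del i l)"
    have dl: "del i l \<in> vertex_lists m" "set (del i l) \<subseteq> V" "length (del i l) - 1 = ?n"
      using less ij del_in_vertex_lists[of l m i] set_del_subset[of i l] by auto
    have z: "?z \<in> B ?n" using degen_act_in_subset[OF dl(1,2)] dl(3) by simp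
    have n: "Suc ?n = length l - 1" using ij less(4) by simp
    have "s (length l - 1) j (degen_act X s m y l) = s (Suc ?n) (Suc (j - 1)) (s ?n i ?z)"
      using degen_act_repeating[OF ri, of X s m y] ij unfolding n by simp
    also have "\<dots> = s (Suc ?n) i (s ?n (j - 1) ?z)"
      using ij less(4) z by (intro simplicial_subsetD(8)[OF B, symmetric]) auto
    also have "s ?n (j - 1) ?z = degen_act X s m y (dup (j - 1) (del i l))"
      using less(1)[OF _ dl(1,2), of "j - 1"] dl(3) less(4) ij by auto
    also have "dup (j - 1) (del i l) = del i (dup j l)" using del_dup_less[OF ij less(4)] by simp
    finally show ?thesis using d n by simp
  qed
qed

lemma face_degen_act:
  assumes X: "semisimplicial_set X" and y: "y \<in> simplices X m"
  shows "\<lbrakk>l \<in> vertex_lists m; set l \<subseteq> V; j < length l; 2 \<le> length l\<rbrakk>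
    \<Longrightarrow> face X (length l - 1) j (degen_act X s m y l) = degen_act X s m y (del j l)"
proof (induction "length l" arbitrary: l j rule: less_induct)
  case less
  show ?case
  proof (cases "\<exists>i. repeats_at l i")
    case True
    then obtain i where i: "repeats_at l i" "\<And>k. k < i \<Longrightarrow> \<not> repeats_at l k"
      using first_repetition by metis
    let ?l = "del i l"
    let ?z = "degen_act X s m y ?l"
    have len: "Suc i < length l" using i by (simp add: repeats_at_def)
    obtain n where n: "length l = Suc (Suc n)" using that[of "length l - 2"] len by simp
    have nl: "length ?l = Suc n" using len n by auto
    have dl: "?l \<in> vertex_lists m" "set ?l \<subseteq> V"
      using less len del_in_vertex_lists[of l m i] set_del_subset[of i l] by auto
    have z: "?z \<in> B n" using degen_act_in_subset[OF dl] nl by simp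
    have f: "face X (length l - 1) j (degen_act X s m y l) = face X (Suc n) j (s n i ?z)"
      by (simp add: degen_act_repeating[OF i] n)
    have ll: "dup i ?l = l" by (rule dup_del[OF i(1)])
    have IH: "face X n k ?z = degen_act X s m y (del k ?l)" if "k \<le> n" "1 \<le> n" for k
      using less(1)[OF _ dl, of k] that n nl by auto
    have DD: "s (n - 1) j (degen_act X s m y (del k ?l)) = degen_act X s m y (dup j (del k ?l))"
      if "k \<le> n" "1 \<le> n" "j < n" for j k
      using degeneracy_degen_act[of "del k ?l" j] del_in_vertex_lists[OF dl(1), of k]
        set_del_subset[of k ?l] dl(2) that nl by auto
    consider "j < i" | "j = i" | "j = Suc i" | "Suc i < j" by linarith
    then have "face X (Suc n) j (s n i ?z) = degen_act X s m y (del j l)"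
    proof cases
      case 1
      have j: "j \<le> n" "1 \<le> n" "i - 1 < n" "i < length ?l" using 1 len n nl by auto
      have "face X (Suc n) j (s n i ?z) = s (n - 1) (i - 1) (face X n j ?z)"
        using 1 len n z by (intro simplicial_subsetD(4)[OF B]) auto
      also have "\<dots> = degen_act X s m y (dup (i - 1) (del j ?l))"
        by (simp only: IH[OF j(1,2)] DD[OF j(1-3)])
      finally show ?thesis by (simp only: del_dup_less[OF 1 j(4), symmetric] ll)
    next
      case 2
      then show ?thesis using simplicial_subsetD(5)[OF B _ z, of i] len n by simp
    next
      case 3
      then show ?thesis using simplicial_subsetD(6)[OF B _ z, of i] len n del_Suc[OF i(1)] by simp
    next
      case 4
      have j: "j - 1 \<le> n" "1 \<le> n" "i < n" "j \<le> length ?l" using 4 less(4) n nl by auto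
      have "face X (Suc n) j (s n i ?z) = s (n - 1) i (face X n (j - 1) ?z)"
        using 4 less(4) n z by (intro simplicial_subsetD(7)[OF B]) auto
      also have "\<dots> = degen_act X s m y (dup i (del (j - 1) ?l))"
        by (simp only: IH[OF j(1,2)] DD[OF j(1-3)])
      finally show ?thesis by (simp only: del_dup_greater[OF 4 j(4), symmetric] ll)
    qed
    then show ?thesis using f by simp
  next
    case False
    then show ?thesis using face_degen_act_nonrepeating[OF X y less(2)] less(4,5) by simp
  qed
qed

lemma map_degen_act:
  assumes p: "semisimplicial_map X Y p" and y: "y \<in> simplices X m"
    and ps: "\<forall>n. \<forall>i\<le>n. \<forall>x\<in>B n. p (Suc n) (s n i x) = sY n i (p n x)"
  shows "\<lbrakk>l \<in> vertex_lists m; set l \<subseteq> V \<or> (\<nexists>i. repeats_at l i)\<rbrakk>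
    \<Longrightarrow> p (length l - 1) (degen_act X s m y l) = degen_act Y sY m (p m y) l"
proof (induction "length l" arbitrary: l rule: less_induct)
  case less
  show ?case
  proof (cases "\<exists>i. repeats_at l i")
    case True
    then obtain i where i: "repeats_at l i" "\<And>k. k < i \<Longrightarrow> \<not> repeats_at l k"
      using first_repetition by metis
    then have len: "Suc i < length l" by (simp add: repeats_at_def)
    let ?n = "length l - 2"
    have dl: "del i l \<in> vertex_lists m" "set (del i l) \<subseteq> V" "length (del i l) - 1 = ?n"
      using less len True del_in_vertex_lists[of l m i] set_del_subset[of i l] by auto
    have "Suc ?n = length l - 1" using len by simp
    then show ?thesis
      using ps[rule_format, of i ?n "degen_act X s m y (del i l)"] degen_act_in_subset[OF dl(1,2)] dl len
        less(1)[of "del i l"] degen_act_repeating[OF i, of X s m y] degen_act_repeating[OF i, of Y sY m "p m y"]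
      by auto
  next
    case False
    then show ?thesis
      using p y nth_in_inj_maps[OF less(2)] by (auto simp: degen_act_nonrepeating semisimplicial_map_def)
  qed
qed

end

section \<open>Filling boundaries with a repeated vertex\<close>

locale lifting_problem =
  fixes X :: "'a semisimplicial" and Y :: "'b semisimplicial" and p :: "nat \<Rightarrow> 'a \<Rightarrow> 'b"
    and sY :: "nat \<Rightarrow> nat \<Rightarrow> 'b \<Rightarrow> 'b" and s0 :: "'a \<Rightarrow> 'a"
  assumes X: "semisimplicial_set X" and Y: "semisimplicial_set Y"
    and inner: "inner_fibration X Y p"
    and sY: "simplicial_structure Y sY"
    and s0_in: "\<And>x. x \<in> simplices X 0 \<Longrightarrow> s0 x \<in> simplices X 1"
    and p_s0: "\<And>x. x \<in> simplices X 0 \<Longrightarrow> p 1 (s0 x) = sY 0 0 (p 0 x)"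
    and s0_edge: "\<And>x. x \<in> simplices X 0 \<Longrightarrow> edge_from_to X (s0 x) x x"
    and s0_idem: "\<And>x. x \<in> simplices X 0 \<Longrightarrow> idempotent X Y sY p (s0 x)"
    and s0_cart: "\<And>x. x \<in> simplices X 0 \<Longrightarrow> cartesian X Y p (s0 x)"
    and s0_cocart: "\<And>x. x \<in> simplices X 0 \<Longrightarrow> cocartesian X Y p (s0 x)"
begin

lemma p_map: "semisimplicial_map X Y p"
  using inner by (simp add: inner_fibration_def)

lemma p_in: "x \<in> simplices X n \<Longrightarrow> p n x \<in> simplices Y n"
  using p_map by (auto simp: semisimplicial_map_def)

lemma Y_simplicial_subset: "simplicial_subset Y (simplices Y) sY"
  using sY face_in_simplices[OF Y] by (auto simp: simplicial_subset_def)

end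

text \<open>
  The inductive situation: \<open>B\<close> is a simplicial subset that contains the \<open>(m - 1)\<close>-skeleton, and the
  degeneracies of \<open>y\<close> are wanted.
\<close>

locale attaching_simplex = lifting_problem +
  fixes B s m y
  assumes B: "simplicial_subset X B s"
    and p_s: "\<And>n i x. \<lbrakk>i \<le> n; x \<in> B n\<rbrakk> \<Longrightarrow> p (Suc n) (s n i x) = sY n i (p n x)"
    and s_0: "\<And>x. x \<in> B 0 \<Longrightarrow> s 0 0 x = s0 x"
    and skeleton: "\<And>k. k < m \<Longrightarrow> simplices X k \<subseteq> B k"
    and y: "y \<in> simplices X m"
begin

definition target :: "nat list \<Rightarrow> 'b" where
  "target l = degen_act Y sY m (p m y) l"

lemma faces_of_target: "faces_in Y (simplices Y) sY m (p m y) UNIV"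
  using semisimplicial_setD(1)[OF Y nth_in_inj_maps p_in[OF y]]
  by (simp add: faces_in_def degen_act_nonrepeating)

lemma target_in: "l \<in> vertex_lists m \<Longrightarrow> target l \<in> simplices Y (length l - 1)"
  unfolding target_def
  using degen_act_in_subset[OF Y_simplicial_subset faces_of_target] by blast

lemma face_target:
  "\<lbrakk>l \<in> vertex_lists m; j < length l; 2 \<le> length l\<rbrakk>
    \<Longrightarrow> face Y (length l - 1) j (target l) = target (del j l)"
  unfolding target_def
  using face_degen_act[OF Y_simplicial_subset faces_of_target Y p_in[OF y]] by blast

text \<open>
  A simplex with the boundary that \<open>f\<close> prescribes for \<open>l\<close> and with the image in \<open>Y\<close> that \<open>p\<close> dictates.
  Thus \<open>fills f l (f l)\<close> says that the choice \<open>f\<close> is compatible with faces at \<open>l\<close>.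
\<close>

definition fills :: "(nat list \<Rightarrow> 'a) \<Rightarrow> nat list \<Rightarrow> 'a \<Rightarrow> bool" where
  "fills f l r \<longleftrightarrow> r \<in> simplices X (length l - 1) \<and> p (length l - 1) r = target l \<and>
     (2 \<le> length l \<longrightarrow> (\<forall>j<length l. face X (length l - 1) j r = f (del j l)))"

lemma horn_of_list:
  assumes l: "l \<in> vertex_lists m" and n: "length l = Suc n" "2 \<le> n" and i: "i \<le> n"
    and x: "\<And>c. \<lbrakk>c \<le> n; c \<noteq> i\<rbrakk> \<Longrightarrow> x c \<in> simplices X (n - 1) \<and> p (n - 1) (x c) = target (del c l)"
    and compat: "\<And>c c'. \<lbrakk>c < c'; c' \<le> n; c \<noteq> i; c' \<noteq> i\<rbrakk>
      \<Longrightarrow> face X (n - 1) c (x c') = face X (n - 1) (c' - 1) (x c)"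
    and first: "i = 0 \<Longrightarrow> first_edge X (n - 1) (x n) \<in> s0 ` simplices X 0"
    and last: "i = n \<Longrightarrow> last_edge X (n - 1) (x 0) \<in> s0 ` simplices X 0"
  obtains w where "w \<in> simplices X n" "p n w = target l"
    "\<And>c. \<lbrakk>c \<le> n; c \<noteq> i\<rbrakk> \<Longrightarrow> face X n c w = x c"
proof -
  have "\<exists>w\<in>simplices X n. p n w = target l \<and> (\<forall>c\<le>n. c \<noteq> i \<longrightarrow> face X n c w = x c)"
  proof (intro horn_filler[OF X Y inner n(2) i])
    show "target l \<in> simplices Y n" using target_in[OF l] n by simp
    show "p (n - 1) (x c) = face Y n c (target l)" if "c \<le> n" "c \<noteq> i" for c
      using face_target[OF l, of c] x[OF that] n that by simp
    show "cocartesian X Y p (first_edge X (n - 1) (x n))" if "i = 0"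
      using first[OF that] s0_cocart by auto
    show "cartesian X Y p (last_edge X (n - 1) (x 0))" if "i = n"
      using last[OF that] s0_cart by auto
  qed (use x compat in auto)
  then show ?thesis using that by blast
qed

text \<open>
  \<open>H\<close> collects the lists for which the simplices \<open>f l\<close> have already been chosen.
\<close>

context
  fixes H :: "nat list set" and f :: "nat list \<Rightarrow> 'a"
  assumes H: "H \<subseteq> vertex_lists m"
    and H_del: "\<And>l j. \<lbrakk>l \<in> H; 2 \<le> length l; j < length l\<rbrakk> \<Longrightarrow> del j l \<in> H"
    and H_fills: "\<And>l. l \<in> H \<Longrightarrow> fills f l (f l)"
begin

lemma first_edge_known:
  "\<lbrakk>l \<in> H; 2 \<le> length l\<rbrakk> \<Longrightarrow> first_edge X (length l - 1) (f l) = f (take 2 l)"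
proof (induction "length l" arbitrary: l rule: less_induct)
  case less
  have fl: "fills f l (f l)" by (rule H_fills[OF less(2)])
  show ?case
  proof (cases "length l = 2")
    case True
    then show ?thesis using fl first_edge_1[OF X, of "f l"] by (simp add: fills_def)
  next
    case False
    let ?d = "del (length l - 1) l"
    have d: "?d \<in> H" "length ?d = length l - 1" "take 2 ?d = take 2 l"
      using H_del[OF less(2,3), of "length l - 1"] less(3) False by (auto simp: del_def min_def)
    have "first_edge X (length l - 1) (f l) = first_edge X (length l - 1 - 1) (f ?d)"
      using first_edge_face[OF X, of "length l - 1" "f l"] fl less(3) False by (auto simp: fills_def)
    then show ?thesis using less(1)[of ?d] d less(3) False by auto
  qed
qed

lemma last_edge_known:
  "\<lbrakk>l \<in> H; 2 \<le> length l\<rbrakk> \<Longrightarrow> last_edge X (length l - 1) (f l) = f (drop (length l - 2) l)"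
proof (induction "length l" arbitrary: l rule: less_induct)
  case less
  then have "l \<noteq> []" by auto
  have fl: "fills f l (f l)" by (rule H_fills[OF less(2)])
  show ?case
  proof (cases "length l = 2")
    case True
    then show ?thesis using fl last_edge_1[OF X, of "f l"] by (simp add: fills_def)
  next
    case False
    let ?d = "del 0 l"
    have "Suc (length l - 1 - 2) = length l - 2" "l \<noteq> []" using less(3) False by auto
    then have d: "?d \<in> H" "length ?d = length l - 1" "drop (length ?d - 2) ?d = drop (length l - 2) l"
      using H_del[OF less(2,3), of 0] less(3) by (auto simp: del_def)
    have "last_edge X (length l - 1) (f l) = last_edge X (length l - 1 - 1) (f ?d)"
      using last_edge_face[OF X, of "length l - 1" "f l"] fl less(3) False \<open>l \<noteq> []\<close>
      by (auto simp: fills_def)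
    then show ?thesis using less(1)[of ?d] d less(3) False by auto
  qed
qed

lemma first_edge_fills:
  assumes r: "fills f l r" and l: "3 \<le> length l" "del (length l - 1) l \<in> H"
  shows "first_edge X (length l - 1) r = f (take 2 l)"
proof -
  have "first_edge X (length l - 1) r = first_edge X (length l - 1 - 1) (f (del (length l - 1) l))"
    using first_edge_face[OF X, of "length l - 1" r] r l by (auto simp: fills_def)
  also have "\<dots> = f (take 2 (del (length l - 1) l))"
    using first_edge_known[OF l(2)] l(1) by simp
  also have "take 2 (del (length l - 1) l) = take 2 l" using l(1) by (simp add: del_def)
  finally show ?thesis .
qed

text \<open>
  The idea, for an edge \<open>h : x \<rightarrow> y\<close>: to fill the boundary \<open>(h, h, e)\<close>, with \<open>e = s\<^sub>0 x\<close>,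
  divide \<open>h\<close> by \<open>e\<close>, say \<open>h = g e\<close>. Then \<open>h e = g e e = g e = h\<close>. In general, \<open>t\<close> is the division, and the
  second horn is the computation, in which \<open>t\<close> is used twice.
\<close>

lemma filler_of_repeated_vertex:
  assumes l: "l \<in> vertex_lists m" and rep: "repeats_at l i" and len: "3 \<le> length l"
    and del1: "\<And>c. c < length l \<Longrightarrow> del c l \<in> H"
    and del2: "\<And>c. \<lbrakk>c \<le> length l; c < i \<or> Suc (Suc i) < c\<rbrakk> \<Longrightarrow> del c (dup i l) \<in> H"
    and edge: "f [l ! i, l ! i] \<in> s0 ` simplices X 0"
  shows "\<exists>r. fills f l r"
proof -
  obtain n where n: "length l = Suc n" "2 \<le> n" using len that[of "length l - 1"] by simp
  have i: "i < n" "l ! Suc i = l ! i" using rep n by (auto simp: repeats_at_def)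
  let ?L = "dup i l"
  have L: "?L \<in> vertex_lists m" "length ?L = Suc (Suc n)"
    using dup_in_vertex_lists[OF l, of i] i n by auto
  have f1: "fills f (del c l) (f (del c l))" if "c \<le> n" for c using H_fills del1 that n by simp
  have F1: "face X (n - 1) k (f (del c l)) = f (del k (del c l))" if "c \<le> n" "k < n" for c k
    using f1[of c] that n by (simp add: fills_def)
  \<comment> \<open>All faces of t are as required, except possibly the i-th.\<close>
  obtain t where t: "t \<in> simplices X n" "p n t = target l"
    "\<And>c. \<lbrakk>c \<le> n; c \<noteq> i\<rbrakk> \<Longrightarrow> face X n c t = f (del c l)"
  proof (rule horn_of_list[OF l n, of i "\<lambda>c. f (del c l)"])
    show "f (del c l) \<in> simplices X (n - 1) \<and> p (n - 1) (f (del c l)) = target (del c l)"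
      if "c \<le> n" "c \<noteq> i" for c using f1[OF that(1)] that n by (simp add: fills_def)
    show "face X (n - 1) c (f (del c' l)) = face X (n - 1) (c' - 1) (f (del c l))"
      if "c < c'" "c' \<le> n" "c \<noteq> i" "c' \<noteq> i" for c c'
      using that n F1[of c' c] F1[of c "c' - 1"] del_del[of c c' l] by simp
    show "first_edge X (n - 1) (f (del n l)) \<in> s0 ` simplices X 0" if "i = 0"
    proof -
      have "take 2 (del n l) = [l ! i, l ! i]"
        using n i that by (intro nth_equalityI) (auto simp: nth_del less_2_cases_iff)
      then show ?thesis using first_edge_known[OF del1, of n] n edge by simp
    qed
  qed (use i in auto)
  have dd: "del c ?L = l" if "c = i \<or> c = Suc i \<or> c = Suc (Suc i)" for c
  proof -
    have "repeats_at ?L (Suc i)" using rep by (auto simp: repeats_at_def nth_dup)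
    then show ?thesis
      using that del_Suc[of ?L "Suc i"] del_dup_same[of i l] del_Suc_dup_same[of i l] i n by auto
  qed
  have f2: "fills f (del c ?L) (f (del c ?L))" if "c \<le> Suc n" "c < i \<or> Suc (Suc i) < c" for c
    using H_fills del2 that n by simp
  have F2: "face X n k (f (del c ?L)) = f (del k (del c ?L))"
    if "c \<le> Suc n" "c < i \<or> Suc (Suc i) < c" "k \<le> n" for c k
    using f2[OF that(1,2)] that L n by (simp add: fills_def)
  \<comment> \<open>The two copies of t meet in the i-th face of t, so the unknown face does no harm.\<close>
  let ?x = "\<lambda>c. if c = i \<or> c = Suc i then t else f (del c ?L)"
  obtain w where w: "w \<in> simplices X (Suc n)" "p (Suc n) w = target ?L"
    "\<And>c. \<lbrakk>c \<le> Suc n; c \<noteq> Suc (Suc i)\<rbrakk> \<Longrightarrow> face X (Suc n) c w = ?x c"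
  proof (rule horn_of_list[OF L, of "Suc (Suc i)" ?x])
    show "?x c \<in> simplices X (Suc n - 1) \<and> p (Suc n - 1) (?x c) = target (del c ?L)"
      if "c \<le> Suc n" "c \<noteq> Suc (Suc i)" for c
    proof (cases "c = i \<or> c = Suc i")
      case False
      then have "c < i \<or> Suc (Suc i) < c" using that by linarith
      from f2[OF that(1) this] False show ?thesis using that L by (simp add: fills_def)
    qed (use t dd in auto)
    show "face X (Suc n - 1) c (?x c') = face X (Suc n - 1) (c' - 1) (?x c)"
      if c: "c < c'" "c' \<le> Suc n" "c \<noteq> Suc (Suc i)" "c' \<noteq> Suc (Suc i)" for c c'
    proof -
      have D: "del c (del c' ?L) = del (c' - 1) (del c ?L)" using c L by (intro del_del) auto
      consider "c = i" "c' = Suc i" | "c < i" "c' = i \<or> c' = Suc i"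
        | "c = i \<or> c = Suc i" "Suc (Suc i) < c'"
        | "c < i \<or> Suc (Suc i) < c" "c' < i \<or> Suc (Suc i) < c'" using c by linarith
      then show ?thesis
      proof cases
        case 2
        then show ?thesis using t(3)[of c] F2[of c "c' - 1"] D dd[of c'] c i by auto
      next
        case 3
        then show ?thesis using t(3)[of "c' - 1"] F2[of c' c] D dd[of c] c i by auto
      next
        case 4
        then show ?thesis using F2[of c "c' - 1"] F2[of c' c] D c by auto
      qed simp
    qed
    show "last_edge X (Suc n - 1) (?x 0) \<in> s0 ` simplices X 0" if "Suc (Suc i) = Suc n"
    proof -
      have i0: "0 < i" using that n by simp
      have "drop (length (del 0 ?L) - 2) (del 0 ?L) = [l ! i, l ! i]"
        using L i0 that n i by (intro nth_equalityI) (auto simp: nth_del nth_dup less_2_cases_iff)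
      then show ?thesis using last_edge_known[OF del2, of 0] i0 edge n L by simp
    qed
  qed (use i n in auto)
  have "fills f l (face X (Suc n) (Suc (Suc i)) w)"
    unfolding fills_def
  proof (intro conjI impI allI)
    show "face X (Suc n) (Suc (Suc i)) w \<in> simplices X (length l - 1)"
      using face_in_simplices[OF X _ _ w(1), of "Suc (Suc i)"] i n by simp
    show "p (length l - 1) (face X (Suc n) (Suc (Suc i)) w) = target l"
      using map_face[OF p_map _ _ w(1), of "Suc (Suc i)"] face_target[OF L(1), of "Suc (Suc i)"] L i n w(2) dd
      by simp
    fix k assume k: "k < length l"
    show "face X (length l - 1) k (face X (Suc n) (Suc (Suc i)) w) = f (del k l)"
    proof (cases "k < Suc (Suc i)")
      case True
      then have "face X n k (face X (Suc n) (Suc (Suc i)) w) = face X n (Suc i) (?x k)"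
        using face_face[OF X _ _ _ w(1), of k "Suc (Suc i)"] w(3)[of k] i n k by simp
      also have "\<dots> = f (del k l)"
      proof (cases "k < i")
        case True
        then show ?thesis
          using F2[of k "Suc i"] del_del[of k "Suc (Suc i)" ?L] dd i n L by simp
      next
        case False
        then show ?thesis using \<open>k < Suc (Suc i)\<close> t(3)[of "Suc i"] del_Suc[OF rep] i by (auto simp: less_Suc_eq)
      qed
      finally show ?thesis using n by simp
    next
      case False
      then have "face X n k (face X (Suc n) (Suc (Suc i)) w) = face X n (Suc (Suc i)) (?x (Suc k))"
        using face_face[OF X _ _ _ w(1), of "Suc (Suc i)" "Suc k"] w(3)[of "Suc k"] i n k by simp
      also have "\<dots> = f (del k l)"
        using F2[of "Suc k" "Suc (Suc i)"] del_del[of "Suc (Suc i)" "Suc k" ?L] dd i n L k False by simp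
      finally show ?thesis using n by simp
    qed
  qed
  then show ?thesis ..
qed

text \<open>
  Fill the horn of \<open>dup i l\<close> that lacks face \<open>i\<close> and has \<open>u0\<close> as its other faces in the block; let \<open>v1\<close> be
  the filler and \<open>r\<close> its new face. With \<open>v1\<close> as faces in the block, fill the horn of the twice enlarged list
  that lacks face \<open>i\<close>. In the new face of this filler, each face in the block is a face \<open>i\<close> of a copy
  of \<open>v1\<close>, that is \<open>r\<close>: the inconsistent \<open>u0\<close> has disappeared.
\<close>

lemma replace_filler:
  assumes l: "l \<in> vertex_lists m" and len: "3 \<le> length l" and lH: "l \<notin> H"
    and q: "1 \<le> q" "i + q \<le> length l" and block: "\<And>k. \<lbrakk>i \<le> k; k < i + q\<rbrakk> \<Longrightarrow> l ! k = l ! i"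
    and u0: "fills f l u0" and del0: "\<And>c. c < length l \<Longrightarrow> del c l \<in> H"
    and del1: "\<And>c. \<lbrakk>c \<le> length l; c < i \<or> i + q < c\<rbrakk> \<Longrightarrow> del c (dup i l) \<in> H"
    and del2: "\<And>c. \<lbrakk>c \<le> Suc (length l); c < i \<or> Suc (i + q) < c\<rbrakk> \<Longrightarrow> del c (dup i (dup i l)) \<in> H"
    and edge: "f [l ! i, l ! i] \<in> s0 ` simplices X 0"
  shows "\<exists>r v. fills f l r \<and> fills (f(l := r)) (dup i l) v"
proof -
  obtain n where n: "length l = Suc n" "2 \<le> n" using len that[of "length l - 1"] by simp
  have i: "i \<le> n" using q n by simp
  let ?L1 = "dup i l"
  let ?L2 = "dup i ?L1"
  have L1: "?L1 \<in> vertex_lists m" "length ?L1 = Suc (Suc n)"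
    using dup_in_vertex_lists[OF l, of i] i n by auto
  have L2: "?L2 \<in> vertex_lists m" "length ?L2 = Suc (Suc (Suc n))"
    using dup_in_vertex_lists[OF L1(1), of i] i L1 by auto
  have nth1: "?L1 ! k = l ! i" if "i \<le> k" "k \<le> i + q" for k
    using that q block[of k] block[of "k - 1"] by (cases "k = i") (auto simp: nth_dup)
  have dd1: "del c ?L1 = l" if "i \<le> c" "c \<le> i + q" for c
  proof (rule nth_equalityI)
    show "length (del c ?L1) = length l" using that q by simp
    fix k assume "k < length (del c ?L1)"
    then show "del c ?L1 ! k = l ! k"
      using that q nth1[of k] block[of k] by (auto simp: nth_del nth_dup)
  qed
  have dd2: "del c ?L2 = ?L1" if "i \<le> c" "c \<le> Suc (i + q)" for c
  proof (rule nth_equalityI)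
    show "length (del c ?L2) = length ?L1" using that q by simp
    fix k assume "k < length (del c ?L2)"
    then show "del c ?L2 ! k = ?L1 ! k"
      using that q nth1[of k] nth1[of "k - 1"] nth1[of i] L1 n by (auto simp: nth_del nth_dup[of _ ?L1])
  qed
  let ?x = "\<lambda>c. if i < c \<and> c \<le> i + q then u0 else f (del c ?L1)"
  have x: "fills f (del c ?L1) (?x c)" if "c \<le> Suc n" "c \<noteq> i" for c
    using u0 dd1[of c] H_fills[OF del1, of c] that n by auto
  have Fx: "face X n k (?x c) = f (del k (del c ?L1))" if "c \<le> Suc n" "c \<noteq> i" "k \<le> n" for c k
    using x[OF that(1,2)] that L1 n by (auto simp: fills_def)
  \<comment> \<open>If the block is the whole list, the last face is u0, whose first edge is determined by its boundary.\<close>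
  have first_x: "first_edge X n (?x (Suc n)) \<in> s0 ` simplices X 0" if "i = 0"
  proof -
    have "del n (del (Suc n) ?L1) \<in> H"
    proof (cases "Suc n \<le> i + q")
      case True
      then show ?thesis using dd1[of "Suc n"] del0[of n] i n by simp
    next
      case False
      then show ?thesis using H_del[OF del1, of "Suc n" n] L1 n by simp
    qed
    moreover have "take 2 (del (Suc n) ?L1) = [l ! i, l ! i]"
      using n that L1 by (intro nth_equalityI) (auto simp: nth_del nth_dup less_Suc_eq)
    ultimately show ?thesis using first_edge_fills[OF x, of "Suc n"] edge L1 n that by simp
  qed
  obtain v1 where v1: "v1 \<in> simplices X (Suc n)" "p (Suc n) v1 = target ?L1"
    "\<And>c. \<lbrakk>c \<le> Suc n; c \<noteq> i\<rbrakk> \<Longrightarrow> face X (Suc n) c v1 = ?x c"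
  proof (rule horn_of_list[OF L1, of i ?x])
    show "?x c \<in> simplices X (Suc n - 1) \<and> p (Suc n - 1) (?x c) = target (del c ?L1)"
      if "c \<le> Suc n" "c \<noteq> i" for c
      using x[OF that] that L1 by (simp only: fills_def length_del) auto
    show "face X (Suc n - 1) c (?x c') = face X (Suc n - 1) (c' - 1) (?x c)"
      if "c < c'" "c' \<le> Suc n" "c \<noteq> i" "c' \<noteq> i" for c c'
    proof -
      have "face X n c (?x c') = f (del c (del c' ?L1))" using that by (intro Fx) auto
      also have "del c (del c' ?L1) = del (c' - 1) (del c ?L1)" using that L1 by (intro del_del) auto
      also have "f \<dots> = face X n (c' - 1) (?x c)" using that by (intro Fx[symmetric]) auto
      finally show ?thesis by simp
    qed
    show "first_edge X (Suc n - 1) (?x (Suc n)) \<in> s0 ` simplices X 0" if "i = 0"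
      using first_x[OF that] by simp
  qed (use i n in auto)
  let ?u1 = "face X (Suc n) i v1"
  have u1: "fills f l ?u1"
    unfolding fills_def
  proof (intro conjI impI allI)
    show "?u1 \<in> simplices X (length l - 1)"
      using face_in_simplices[OF X _ _ v1(1), of i] i n by simp
    show "p (length l - 1) ?u1 = target l"
      using map_face[OF p_map _ _ v1(1), of i] face_target[OF L1(1), of i] L1 i n v1(2) dd1[of i] by simp
    fix k assume k: "k < length l"
    have "face X n k ?u1 = f (del k l)"
    proof (cases "k < i")
      case True
      then have "face X n k ?u1 = face X n (i - 1) (?x k)"
        using face_face[OF X _ True _ v1(1)] v1(3)[of k] i n by simp
      also have "\<dots> = f (del (i - 1) (del k ?L1))" using True i by (intro Fx) auto
      also have "del (i - 1) (del k ?L1) = del k (del i ?L1)" using True i L1 by (intro del_del[symmetric]) auto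
      finally show ?thesis using dd1[of i] by simp
    next
      case False
      then have "face X n k ?u1 = face X n i (?x (Suc k))"
        using face_face[OF X _ _ _ v1(1), of i "Suc k"] v1(3)[of "Suc k"] i n k by simp
      also have "\<dots> = f (del i (del (Suc k) ?L1))" using False i n k by (intro Fx) auto
      also have "del i (del (Suc k) ?L1) = del k (del i ?L1)"
        using del_del[of i "Suc k" ?L1] False L1 n k by simp
      finally show ?thesis using dd1[of i] by simp
    qed
    then show "face X (length l - 1) k ?u1 = f (del k l)" using n by simp
  qed
  let ?z = "\<lambda>c. if i < c \<and> c \<le> Suc (i + q) then v1 else f (del c ?L2)"
  have f2: "fills f (del c ?L2) (f (del c ?L2))" if "c \<le> Suc (Suc n)" "c < i \<or> Suc (i + q) < c" for c
    using H_fills del2 that n by simp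
  have F2: "face X (Suc n) k (f (del c ?L2)) = f (del k (del c ?L2))"
    if "c \<le> Suc (Suc n)" "c < i \<or> Suc (i + q) < c" "k \<le> Suc n" for c k
    using f2[OF that(1,2)] that L2 n by (simp add: fills_def)
  obtain w where w: "w \<in> simplices X (Suc (Suc n))" "p (Suc (Suc n)) w = target ?L2"
    "\<And>c. \<lbrakk>c \<le> Suc (Suc n); c \<noteq> i\<rbrakk> \<Longrightarrow> face X (Suc (Suc n)) c w = ?z c"
  proof (rule horn_of_list[OF L2, of i ?z])
    show "?z c \<in> simplices X (Suc (Suc n) - 1) \<and> p (Suc (Suc n) - 1) (?z c) = target (del c ?L2)"
      if "c \<le> Suc (Suc n)" "c \<noteq> i" for c
    proof (cases "i < c \<and> c \<le> Suc (i + q)")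
      case True
      then show ?thesis using v1 dd2[of c] by simp
    next
      case False
      then have "c < i \<or> Suc (i + q) < c" using that by linarith
      from f2[OF that(1) this] have "f (del c ?L2) \<in> simplices X (Suc n) \<and> p (Suc n) (f (del c ?L2)) = target (del c ?L2)"
        using that L2 by (simp add: fills_def)
      then show ?thesis unfolding if_not_P[OF False] by simp
    qed
    show "face X (Suc (Suc n) - 1) c (?z c') = face X (Suc (Suc n) - 1) (c' - 1) (?z c)"
      if c: "c < c'" "c' \<le> Suc (Suc n)" "c \<noteq> i" "c' \<noteq> i" for c c'
    proof -
      have D: "del c (del c' ?L2) = del (c' - 1) (del c ?L2)" using c L2 by (intro del_del) auto
      consider "i < c" "c' \<le> Suc (i + q)" | "c < i" "i < c'" "c' \<le> Suc (i + q)"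
        | "i < c" "c \<le> Suc (i + q)" "Suc (i + q) < c'"
        | "c < i \<or> Suc (i + q) < c" "c' < i \<or> Suc (i + q) < c'" using c by linarith
      then show ?thesis
      proof cases
        \<comment> \<open>Two copies of v1 meet in a face of v1 in the block other than the i-th, which is u0.\<close>
        case 1
        then have "i < c' - 1" "c' - 1 \<le> i + q" "c \<le> i + q" using c by auto
        then show ?thesis using v1(3)[of c] v1(3)[of "c' - 1"] 1 c by simp
      next
        case 2
        then show ?thesis using v1(3)[of c] F2[of c "c' - 1"] D dd2[of c'] c by simp
      next
        case 3
        then have "c' - 1 \<noteq> i" "\<not> c' - 1 \<le> i + q" by auto
        then show ?thesis using v1(3)[of "c' - 1"] F2[of c' c] D dd2[of c] 3 c by simp
      next
        case 4
        then show ?thesis using F2[of c "c' - 1"] F2[of c' c] D c by auto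
      qed
    qed
    show "first_edge X (Suc (Suc n) - 1) (?z (Suc (Suc n))) \<in> s0 ` simplices X 0" if "i = 0"
    proof (cases "Suc (Suc n) \<le> Suc (i + q)")
      case True
      then show ?thesis
        using first_edge_face[OF X _ v1(1)] v1(3)[of "Suc n"] first_x[OF that] n that by simp
    next
      case False
      have "take 2 (del (Suc (Suc n)) ?L2) = [l ! i, l ! i]"
        using n that L1 L2 by (intro nth_equalityI) (auto simp: nth_del nth_dup less_Suc_eq)
      then show ?thesis using first_edge_known[OF del2, of "Suc (Suc n)"] False edge n L2 that by simp
    qed
  qed (use i n in auto)
  have "fills (f(l := ?u1)) ?L1 (face X (Suc (Suc n)) i w)"
    unfolding fills_def
  proof (intro conjI impI allI)
    show "face X (Suc (Suc n)) i w \<in> simplices X (length ?L1 - 1)"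
      using face_in_simplices[OF X _ _ w(1), of i] i L1 by simp
    show "p (length ?L1 - 1) (face X (Suc (Suc n)) i w) = target ?L1"
      using map_face[OF p_map _ _ w(1), of i] face_target[OF L2(1), of i] L1 L2 i n w(2) dd2[of i] by simp
    fix k assume k: "k < length ?L1"
    let ?r = "face X (Suc n) k (face X (Suc (Suc n)) i w)"
    consider "i \<le> k" "k \<le> i + q" | "k < i" | "i + q < k" by linarith
    then have "?r = (f(l := ?u1)) (del k ?L1)"
    proof cases
      case 1
      then show ?thesis
        using face_face[OF X _ _ _ w(1), of i "Suc k"] w(3)[of "Suc k"] dd1[of k] L1 k by simp
    next
      case 2
      then have "?r = f (del (i - 1) (del k ?L2))"
        using face_face[OF X _ 2 _ w(1)] w(3)[of k] F2[of k "i - 1"] i n by simp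
      also have "del (i - 1) (del k ?L2) = del k ?L1"
        using del_del[OF 2, of ?L2] dd2[of i] i L2 by simp
      finally show ?thesis using del1[of k] lH 2 i n by auto
    next
      case 3
      then have "?r = f (del i (del (Suc k) ?L2))"
        using face_face[OF X _ _ _ w(1), of i "Suc k"] w(3)[of "Suc k"] F2[of "Suc k" i] i L1 k by simp
      also have "del i (del (Suc k) ?L2) = del k ?L1"
        using del_del[of i "Suc k" ?L2] dd2[of i] 3 L1 L2 k by simp
      finally show ?thesis using del1[of k] lH 3 k L1 n by auto
    qed
    then show "face X (length ?L1 - 1) k (face X (Suc (Suc n)) i w) = (f(l := ?u1)) (del k ?L1)"
      using L1 by simp
  qed
  with u1 show ?thesis by blast
qed

end

end

section \<open>Degenerate lists and the order of choice\<close>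

text \<open>
  The lists for which a simplex has to be chosen: a list that misses a vertex of the \<open>m\<close>-simplex belongs to
  a proper face, and the only injective list that remains is the identity.
\<close>

definition degenerate :: "nat \<Rightarrow> nat list \<Rightarrow> bool" where
  "degenerate m l \<longleftrightarrow> set l = {..m} \<and> (\<exists>i. repeats_at l i)"

definition top_repeated :: "nat list \<Rightarrow> nat" where
  "top_repeated l = Max {v. 2 \<le> count_list l v}"

text \<open>
  A degenerate list consists of a head, a maximal block of the last repeated vertex \<open>b\<close>, and each vertex after
  \<open>b\<close> exactly once; see \<open>block_list\<close>.
\<close>

definition head_length :: "nat list \<Rightarrow> nat" where
  "head_length l = length (takeWhile (\<lambda>v. v < top_repeated l) l)"

text \<open>
  Lexicographic in the length of the head and the total length, with the lists that require no choice below all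
  others. Enlarging the block keeps the head; deleting an entry outside of the block shortens the head or makes
  the list miss a vertex. So the simplices that the two filling constructions need, however large the block,
  come earlier.
\<close>

definition precedes :: "nat \<Rightarrow> nat list \<Rightarrow> nat list \<Rightarrow> bool" where
  "precedes m l' l \<longleftrightarrow> degenerate m l \<and> (degenerate m l' \<longrightarrow>
     head_length l' < head_length l \<or> head_length l' = head_length l \<and> length l' < length l)"

definition block_list :: "nat \<Rightarrow> nat list \<Rightarrow> nat \<Rightarrow> nat \<Rightarrow> nat list" where
  "block_list m pre q b = pre @ replicate q b @ [Suc b..<Suc m]"

lemma wf_precedes: "wf {(l', l). precedes m l' l}"
  by (rule wf_subset[OF wf_measures[of "[\<lambda>l. if degenerate m l then Suc (head_length l) else 0, length]"]])
    (auto simp: precedes_def)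

lemma precedes_trans: "\<lbrakk>precedes m l l'; precedes m l' l''\<rbrakk> \<Longrightarrow> precedes m l l''"
  by (auto simp: precedes_def)

lemma in_set_if_repeated: "2 \<le> count_list l v \<Longrightarrow> v \<in> set l"
  using count_list_0_iff[of l v] by fastforce

lemma finite_repeated: "finite {v. 2 \<le> count_list l v}"
  by (rule finite_subset[of _ "set l"]) (auto dest: in_set_if_repeated)

lemma count_list_replicate: "count_list (replicate q b) b = q"
  by (induction q) auto

lemma length_takeWhile_less: "\<lbrakk>x \<in> set l; \<not> P x\<rbrakk> \<Longrightarrow> length (takeWhile P l) < length l"
  by (induction l) auto

lemma count_list_distinct: "distinct l \<Longrightarrow> count_list l v \<le> 1"
  by (induction l) (auto simp: count_list_0_iff)

lemma repeated_if_not_distinct: "\<not> distinct l \<Longrightarrow> \<exists>v. 2 \<le> count_list l v"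
  using not_distinct_decomp[of l] by fastforce

lemma count_list_filter: "count_list (filter P l) v \<le> count_list l v"
  by (induction l) auto

lemma not_distinct_if_repeats: "repeats_at l i \<Longrightarrow> \<not> distinct l"
  using nth_eq_iff_index_eq[of l i "Suc i"] by (auto simp: repeats_at_def)

lemma distinct_if_nonrepeating: "\<lbrakk>sorted l; \<nexists>i. repeats_at l i\<rbrakk> \<Longrightarrow> distinct l"
  using nonrepeating_strict[of l] by (auto simp: distinct_conv_nth) (metis less_irrefl linorder_neqE_nat)

lemma sorted_split:
  "sorted l \<Longrightarrow> l = filter (\<lambda>v. v < b) l @ replicate (count_list l b) b @ filter (\<lambda>v. b < v) (l :: nat list)"
proof (induction l)
  case (Cons a l)
  have [simp]: "filter (\<lambda>v. v < b) l = []" if "b \<le> a"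
    using Cons.prems that by (auto simp: filter_empty_conv)
  have [simp]: "count_list l b = 0" if "b < a"
    using Cons.prems that by (auto simp: count_list_0_iff)
  consider "a < b" | "a = b" | "b < a" by linarith
  then show ?case using Cons by cases auto
qed simp

lemma degenerate_decomp:
  assumes l: "l \<in> vertex_lists m" and d: "degenerate m l"
  obtains pre q b where "l = block_list m pre q b" "2 \<le> q" "b \<le> m" "\<forall>v\<in>set pre. v < b"
proof -
  let ?S = "{v. 2 \<le> count_list l v}"
  define b where "b = Max ?S"
  have s: "sorted l" "set l = {..m}" using l d by (auto simp: vertex_lists_def degenerate_def)
  have "?S \<noteq> {}"
    using d not_distinct_if_repeats repeated_if_not_distinct by (auto simp: degenerate_def)
  then have b: "2 \<le> count_list l b" using Max_in[OF finite_repeated, of l] b_def by simp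
  then have "b \<in> set l" by (rule in_set_if_repeated)
  then have bm: "b \<le> m" using s by simp
  let ?t = "filter (\<lambda>v. b < v) l"
  have "distinct ?t"
  proof (rule ccontr)
    assume "\<not> distinct ?t"
    then obtain v where v: "2 \<le> count_list ?t v" using repeated_if_not_distinct by auto
    then have "b < v" using in_set_if_repeated[of ?t v] by simp
    moreover have "v \<in> ?S" using v count_list_filter[of "\<lambda>v. b < v" l v] by simp
    ultimately show False using Max_ge[OF finite_repeated, of v l] b_def by simp
  qed
  then have "?t = [Suc b..<Suc m]"
    using s sorted_wrt_filter[of "(\<le>)" l]
    by (intro sorted_distinct_set_unique) (auto simp del: upt_Suc)
  then have e: "l = block_list m (filter (\<lambda>v. v < b) l) (count_list l b) b"
    using sorted_split[OF s(1), of b] unfolding block_list_def by (simp only:)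
  show ?thesis by (rule that[OF e b bm]) simp
qed

context
  fixes m b :: nat and pre :: "nat list"
  assumes b: "b \<le> m" and pre: "\<forall>v\<in>set pre. v < b"
begin

lemma set_block_list: "1 \<le> q \<Longrightarrow> set (block_list m pre q b) = set pre \<union> {b..m}"
  using b by (auto simp: block_list_def)

lemma length_block_list: "length (block_list m pre q b) = length pre + q + (m - b)"
  using b by (auto simp: block_list_def)

lemma head_length_block_list:
  assumes "2 \<le> q"
  shows "head_length (block_list m pre q b) = length pre"
proof -
  let ?l = "block_list m pre q b"
  have "count_list ?l v = count_list [Suc b..<Suc m] v" if "b < v" for v
    using pre that by (auto simp: block_list_def count_list_0_iff)
  then have "count_list ?l v \<le> 1" if "b < v" for v
    using that count_list_distinct[OF distinct_upt] by metis
  then have "v \<le> b" if "2 \<le> count_list ?l v" for v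
    using that by (metis Suc_1 not_less_eq_eq leI)
  moreover have "2 \<le> count_list ?l b" using assms by (simp add: block_list_def count_list_replicate)
  ultimately have "top_repeated ?l = b"
    unfolding top_repeated_def
    by (intro Max_eqI finite_repeated) simp_all
  moreover have "takeWhile (\<lambda>v. v < b) ?l = pre"
    using pre assms by (cases q) (auto simp: block_list_def takeWhile_append)
  ultimately show ?thesis by (simp add: head_length_def)
qed

end

context
  fixes m b :: nat and pre :: "nat list"
  assumes b: "b \<le> m" and pre: "\<forall>v\<in>set pre. v < b"
begin

text \<open>
  When the block has shrunk to a single vertex, the last repeated vertex lies in the old head.
\<close>

lemma head_length_single_block:
  assumes "degenerate m (block_list m pre 1 b)"
  shows "head_length (block_list m pre 1 b) < length pre"
proof -
  let ?l = "block_list m pre 1 b"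
  let ?S = "{v. 2 \<le> count_list ?l v}" and ?t = "top_repeated ?l"
  have "?S \<noteq> {}"
    using assms not_distinct_if_repeats repeated_if_not_distinct by (auto simp: degenerate_def)
  then have t: "2 \<le> count_list ?l ?t" using Max_in[OF finite_repeated, of ?l] by (simp add: top_repeated_def)
  have "?t \<in> set pre"
  proof (rule ccontr)
    assume "?t \<notin> set pre"
    then have "count_list ?l ?t = count_list (b # [Suc b..<Suc m]) ?t"
      by (simp add: block_list_def)
    also have "\<dots> \<le> 1" by (rule count_list_distinct) auto
    finally show False using t by simp
  qed
  then show ?thesis
    using takeWhile_append1[of ?t pre "\<lambda>v. v < ?t"] length_takeWhile_less[of ?t pre "\<lambda>v. v < ?t"]
    by (auto simp: head_length_def block_list_def)
qed

lemma degenerate_block_list: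
  assumes "degenerate m (block_list m pre q b)" "1 \<le> q" "2 \<le> q'"
  shows "degenerate m (block_list m pre q' b)"
proof -
  have "repeats_at (block_list m pre q' b) (length pre)"
    using assms(3) by (auto simp: repeats_at_def block_list_def nth_append)
  then show ?thesis using assms set_block_list[OF b pre, of q] set_block_list[OF b pre, of q'] by (auto simp: degenerate_def)
qed

lemma del_block: "\<lbrakk>length pre \<le> c; c < length pre + q\<rbrakk>
    \<Longrightarrow> del c (block_list m pre q b) = block_list m pre (q - 1) b"
  by (rule nth_equalityI) (auto simp: block_list_def nth_del nth_append)

lemma dup_block: "1 \<le> q \<Longrightarrow> dup (length pre) (block_list m pre q b) = block_list m pre (Suc q) b"
  by (cases q) (auto simp: block_list_def dup_def)

lemma precedes_block:
  assumes "degenerate m (block_list m pre q b)" "2 \<le> q"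
  shows "precedes m (block_list m pre (q - 1) b) (block_list m pre q b)"
proof (cases "q = 2")
  case True
  then show ?thesis
    using assms head_length_single_block head_length_block_list[OF b pre, of q] by (auto simp: precedes_def)
next
  case False
  then show ?thesis
    using assms head_length_block_list[OF b pre, of q] head_length_block_list[OF b pre, of "q - 1"]
    by (auto simp: precedes_def length_block_list[OF b pre])
qed

text \<open>
  The size \<open>q'\<close> of the block is independent of \<open>q\<close>: this allows the filling constructions to look at
  larger blocks.
\<close>

lemma precedes_off_block:
  assumes d: "degenerate m (block_list m pre q b)" and q: "2 \<le> q" "2 \<le> q'"
    and c: "c < length (block_list m pre q' b)" "c < length pre \<or> length pre + q' \<le> c"
  shows "precedes m (del c (block_list m pre q' b)) (block_list m pre q b)"
proof (cases "c < length pre")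
  case True
  have "del c (block_list m pre q' b) = block_list m (del c pre) q' b"
    using True by (auto simp: block_list_def del_def)
  moreover have "head_length (block_list m (del c pre) q' b) = length (del c pre)"
    using set_del_subset[of c pre] pre b q
    by (intro head_length_block_list) auto
  ultimately show ?thesis
    using d True head_length_block_list[OF b pre q(1)] by (auto simp: precedes_def)
next
  case False
  define j where "j = c - (length pre + q')"
  have j: "c = length pre + q' + j" "Suc b + j \<le> m" using c False by (auto simp: j_def length_block_list[OF b pre])
  have dl: "del c (block_list m pre q' b) = pre @ replicate q' b @ del j [Suc b..<Suc m]"
    using j by (auto simp: block_list_def del_def)
  have "Suc b + j \<notin> set (del j [Suc b..<Suc m])"
    using j by (auto simp: in_set_conv_nth nth_del split: if_splits simp del: upt_Suc)
  then have "Suc b + j \<notin> set (del c (block_list m pre q' b))"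
    using pre by (auto simp: dl)
  then have "\<not> degenerate m (del c (block_list m pre q' b))" using j by (auto simp: degenerate_def)
  then show ?thesis using d by (simp add: precedes_def)
qed

end

lemma precedes_del:
  assumes l: "l \<in> vertex_lists m" and d: "degenerate m l" and c: "c < length l"
  shows "precedes m (del c l) l"
proof -
  obtain pre q b where D: "l = block_list m pre q b" "2 \<le> q" "b \<le> m" "\<forall>v\<in>set pre. v < b"
    by (rule degenerate_decomp[OF l d]) blast
  show ?thesis
    using D d c precedes_block[OF D(3,4), of q] precedes_off_block[OF D(3,4) _ D(2,2), of c]
      del_block[OF D(3,4), of c q] by (cases "length pre \<le> c \<and> c < length pre + q") auto
qed

lemma del_nondegenerate:
  assumes l: "l \<in> vertex_lists m" "\<not> degenerate m l" and c: "c < length l"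
  shows "\<not> degenerate m (del c l)"
  using assms set_del_subset[of c l] del_nonrepeating[of l c]
  by (auto simp: degenerate_def vertex_lists_def)

lemma singleton_eq_atMost: "{b} = {..m} \<longleftrightarrow> b = 0 \<and> m = (0::nat)"
proof
  assume e: "{b} = {..m}"
  have "0 \<in> {b}" "m \<in> {b}" unfolding e by auto
  then show "b = 0 \<and> m = 0" by auto
qed auto

section \<open>The degeneracies of one simplex\<close>

context attaching_simplex
begin

text \<open>
  An injective list that misses a vertex has fewer than \<open>m + 1\<close> entries, so its simplex lies in the skeleton.
\<close>

lemma nonrepeating_in_subset:
  assumes "l \<in> vertex_lists m" "\<nexists>i. repeats_at l i" "set l \<noteq> {..m}"
  shows "degen_act X s m y l \<in> B (length l - 1)"
proof -
  have "set l \<subset> {..m}" using assms by (auto simp: vertex_lists_def)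
  then have "card (set l) < Suc m" using psubset_card_mono[of "{..m}" "set l"] by simp
  then have "length l - 1 < m"
    using distinct_card[OF distinct_if_nonrepeating, of l] assms by (cases l) (auto simp: vertex_lists_def)
  then show ?thesis
    using skeleton semisimplicial_setD(1)[OF X nth_in_inj_maps y] assms
    by (auto simp: degen_act_nonrepeating)
qed

lemma faces_in_proper_subset: "V \<subset> {..m} \<Longrightarrow> faces_in X B s m y V"
  unfolding faces_in_def using nonrepeating_in_subset by blast

lemma p_degen_act:
  assumes "l \<in> vertex_lists m" "set l \<subset> {..m} \<or> (\<nexists>i. repeats_at l i)"
  shows "p (length l - 1) (degen_act X s m y l) = target l"
proof -
  have "(if set l \<subset> {..m} then set l else {}) \<subset> {..m}" by auto
  note F = faces_in_proper_subset[OF this]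
  have "\<forall>n. \<forall>i\<le>n. \<forall>x\<in>B n. p (Suc n) (s n i x) = sY n i (p n x)" using p_s by simp
  from map_degen_act[OF B F p_map y this assms(1)] assms(2) show ?thesis
    unfolding target_def by (cases "set l \<subset> {..m}") simp_all
qed

lemma degen_act_known:
  assumes l: "l \<in> vertex_lists m" "\<not> degenerate m l"
  shows "fills (degen_act X s m y) l (degen_act X s m y l)"
proof (cases "\<exists>i. repeats_at l i")
  case True
  then have V: "set l \<subset> {..m}" using l by (auto simp: degenerate_def vertex_lists_def)
  note F = faces_in_proper_subset[OF V]
  show ?thesis
    using degen_act_in_subset[OF B F l(1)] simplicial_subsetD(1)[OF B] face_degen_act[OF B F X y l(1)]
      p_degen_act[OF l(1)] V
    by (auto simp: fills_def)
next
  case False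
  show ?thesis
    using semisimplicial_setD(1)[OF X nth_in_inj_maps[OF l(1) False] y]
      face_degen_act_nonrepeating[OF X y l(1) False] p_degen_act[OF l(1)] False
    by (auto simp: fills_def degen_act_nonrepeating)
qed

text \<open>
  The critical edge of an outer horn is the degeneracy of a vertex of \<open>y\<close>.
\<close>

lemma degen_act_vertex_pair:
  assumes "b \<le> m" "0 < m"
  shows "degen_act X s m y [b, b] \<in> s0 ` simplices X 0"
proof -
  have "{b} \<subset> {..m}" using assms singleton_eq_atMost[of b m] by auto
  note F = faces_in_proper_subset[OF this]
  have l: "[b] \<in> vertex_lists m" using assms by (auto simp: vertex_lists_def)
  have "degen_act X s m y [b, b] = s 0 0 (degen_act X s m y [b])"
    using degeneracy_degen_act[OF B F l, of 0] by (simp add: dup_def)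
  moreover have "degen_act X s m y [b] \<in> B 0"
    using degen_act_in_subset[OF B F l] by simp
  ultimately show ?thesis using s_0 simplicial_subsetD(1)[OF B] by auto
qed

lemma target_dup:
  "\<lbrakk>l \<in> vertex_lists m; j < length l\<rbrakk> \<Longrightarrow> target (dup j l) = sY (length l - 1) j (target l)"
  unfolding target_def
  using degeneracy_degen_act[OF Y_simplicial_subset faces_of_target] by auto

lemma fills_cong:
  assumes "\<And>j. j < length l \<Longrightarrow> f (del j l) = g (del j l)"
  shows "fills f l r = fills g l r"
  using assms by (auto simp: fills_def)

text \<open>
  The invariant of the recursion: the simplex \<open>r\<close> chosen for \<open>l\<close> fits, and so does some simplex for the list
  with one more entry in the block, if \<open>r\<close> is used for its faces in the block.
\<close>

definition extendable :: "(nat list \<Rightarrow> 'a) \<Rightarrow> nat list \<Rightarrow> 'a \<Rightarrow> bool" where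
  "extendable f l r \<longleftrightarrow> fills f l r \<and> (\<exists>v. fills (f(l := r)) (dup (head_length l) l) v)"

definition admissible :: "(nat list \<Rightarrow> 'a) \<Rightarrow> nat list \<Rightarrow> 'a \<Rightarrow> bool" where
  "admissible f l r \<longleftrightarrow> (l \<in> vertex_lists m \<longrightarrow>
     (if degenerate m l then extendable f l r \<and> (l = [0, 0] \<longrightarrow> r = s0 y)
      else r = degen_act X s m y l))"

lemma admissible_cong:
  assumes fg: "\<And>l'. precedes m l' l \<Longrightarrow> f l' = g l'"
  shows "admissible f l r = admissible g l r"
proof (cases "l \<in> vertex_lists m \<and> degenerate m l")
  case True
  then have l: "l \<in> vertex_lists m" "degenerate m l" by auto
  obtain pre q b where D: "l = block_list m pre q b" "2 \<le> q" "b \<le> m" "\<forall>v\<in>set pre. v < b"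
    by (rule degenerate_decomp[OF l]) blast
  have h: "head_length l = length pre" using head_length_block_list[OF D(3,4,2)] D(1) by simp
  have dl: "dup (head_length l) l = block_list m pre (Suc q) b"
    using dup_block[OF D(3,4), of q] D(1,2) h by simp
  have "(f(l := r)) (del j (dup (head_length l) l)) = (g(l := r)) (del j (dup (head_length l) l))"
    if "j < length (dup (head_length l) l)" for j
  proof (cases "length pre \<le> j \<and> j < length pre + Suc q")
    case True
    then show ?thesis using del_block[OF D(3,4), of j "Suc q"] dl D(1) by simp
  next
    case False
    then show ?thesis
      using precedes_off_block[OF D(3,4) _ D(2), of "Suc q" j] D l(2) that fg unfolding dl by auto
  qed
  then have "fills (f(l := r)) (dup (head_length l) l) v = fills (g(l := r)) (dup (head_length l) l) v" for v
    by (rule fills_cong)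
  moreover have "fills f l r = fills g l r" using precedes_del[OF l] fg by (intro fills_cong) auto
  ultimately show ?thesis by (simp add: admissible_def extendable_def)
qed (auto simp: admissible_def)

text \<open>
  For a vertex, the first degeneracy is prescribed, and idempotency is exactly its extendability.
\<close>

lemma admissible_vertex:
  assumes m: "m = 0" and f: "admissible f [0] (f [0])"
  shows "admissible f [0, 0] (s0 y)"
proof -
  have l0: "[0] \<in> vertex_lists m" "[0, 0] \<in> vertex_lists m" using m by (auto simp: vertex_lists_def)
  have y0: "y \<in> simplices X 0" using y m by simp
  have id: "(\<lambda>k\<in>{..0::nat}. [0::nat] ! k) = (\<lambda>k\<in>{..0}. k)" by (auto simp: fun_eq_iff)
  have nr: "\<nexists>i. repeats_at [0] i" by (auto simp: repeats_at_def)
  have dy: "degen_act X s m y [0] = y"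
    using degen_act_nonrepeating[OF nr, of X s m y] semisimplicial_setD(2)[OF X y0] m id by simp
  have dp: "target [0] = p 0 y"
    unfolding target_def
    using degen_act_nonrepeating[OF nr, of Y sY m "p m y"] semisimplicial_setD(2)[OF Y p_in[OF y0]] m id by simp
  have f0: "f [0] = y" using f l0 nr dy by (auto simp: admissible_def degenerate_def)
  have t1: "target [0, 0] = sY 0 0 (p 0 y)" using target_dup[OF l0(1), of 0] dp by (simp add: dup_def)
  have t2: "target [0, 0, 0] = sY 1 0 (sY 0 0 (p 0 y))" using target_dup[OF l0(2), of 0] t1 by (simp add: dup_def)
  have e: "face X 1 0 (s0 y) = y" "face X 1 1 (s0 y) = y"
    using s0_edge[OF y0] by (auto simp: edge_from_to_def)
  obtain x \<sigma> where \<sigma>: "edge_from_to X (s0 y) x x" "\<sigma> \<in> simplices X 2" "\<forall>i\<le>2. face X 2 i \<sigma> = s0 y"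
    "p 2 \<sigma> = sY 1 0 (sY 0 0 (p 0 x))"
    using s0_idem[OF y0] by (auto simp: idempotent_def)
  have x: "x = y" using \<sigma>(1) e by (simp add: edge_from_to_def)
  have "fills f [0, 0] (s0 y)"
    using s0_in[OF y0] p_s0[OF y0] t1 e f0 by (auto simp: fills_def del_def less_Suc_eq)
  moreover have bl: "[0, 0] = block_list m [] 2 0" using m by (simp add: block_list_def numeral_2_eq_2)
  have "head_length [0, 0] = 0" using head_length_block_list[of 0 m "[]" 2] unfolding bl by simp
  moreover have "fills (f([0, 0] := s0 y)) [0, 0, 0] \<sigma>"
    using \<sigma> t2 x by (auto simp: fills_def del_def less_Suc_eq numeral_2_eq_2)
  ultimately have "extendable f [0, 0] (s0 y)" by (auto simp: extendable_def dup_def)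
  moreover have "degenerate m [0, 0]" using m by (auto simp: degenerate_def repeats_at_def)
  ultimately show ?thesis by (simp add: admissible_def)
qed

text \<open>
  The boundary of \<open>l\<close> is first filled by any simplex: by \<open>filler_of_repeated_vertex\<close> if the block has length
  two, and otherwise by extendability of the choice for the list with a shorter block. Then the filler is
  replaced by an extendable one.
\<close>

lemma admissible_step:
  assumes f: "\<And>l'. precedes m l' l \<Longrightarrow> admissible f l' (f l')"
  shows "\<exists>r. admissible f l r"
proof (cases "l \<in> vertex_lists m \<and> degenerate m l")
  case True
  then have l: "l \<in> vertex_lists m" "degenerate m l" by auto
  show ?thesis
  proof (cases "l = [0, 0]")
    case True
    then have "m = 0" using l singleton_eq_atMost[of 0 m] by (auto simp: degenerate_def)
    moreover have "precedes m [0] l" using l(2) by (auto simp: precedes_def degenerate_def repeats_at_def)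
    ultimately show ?thesis using admissible_vertex f True by auto
  next
    case False
    obtain pre q b where D: "l = block_list m pre q b" "2 \<le> q" "b \<le> m" "\<forall>v\<in>set pre. v < b"
      by (rule degenerate_decomp[OF l]) blast
    let ?i = "length pre"
    have h: "head_length l = ?i" using head_length_block_list[OF D(3,4,2)] D(1) by simp
    have d1: "dup ?i l = block_list m pre (Suc q) b" using dup_block[OF D(3,4), of q] D(1,2) by simp
    have d2: "dup ?i (dup ?i l) = block_list m pre (Suc (Suc q)) b"
      using dup_block[OF D(3,4), of "Suc q"] d1 by simp
    have nthl: "l ! k = b" if "?i \<le> k" "k < ?i + q" for k
      using that D(1) by (auto simp: block_list_def nth_append)
    have llen: "length l = ?i + q + (m - b)" using D(1) length_block_list[OF D(3,4)] by simp
    have len: "3 \<le> length l"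
    proof (rule ccontr)
      assume "\<not> 3 \<le> length l"
      then have "q = 2 \<and> length pre = 0 \<and> m = b" using D(2,3) llen by linarith
      then have "l = [b, b]" using D(1) by (simp add: block_list_def numeral_2_eq_2)
      then have "l = [0, 0]" using l(2) singleton_eq_atMost[of b m] by (auto simp: degenerate_def)
      then show False using False by simp
    qed
    define H where "H = {l' \<in> vertex_lists m. precedes m l' l}"
    have H: "H \<subseteq> vertex_lists m" by (auto simp: H_def)
    have H_del: "del j l' \<in> H" if "l' \<in> H" "2 \<le> length l'" "j < length l'" for l' j
    proof -
      have v: "l' \<in> vertex_lists m" and s: "precedes m l' l" using that(1) by (auto simp: H_def)
      have "precedes m (del j l') l"
      proof (cases "degenerate m l'")
        case True
        then show ?thesis using precedes_del[OF v True that(3)] s precedes_trans by blast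
      next
        case False
        then show ?thesis using del_nondegenerate[OF v False that(3)] l(2) by (simp add: precedes_def)
      qed
      then show ?thesis using del_in_vertex_lists[OF v that(3,2)] by (simp add: H_def)
    qed
    have H_fills: "fills f l' (f l')" if "l' \<in> H" for l'
    proof (cases "degenerate m l'")
      case True
      then show ?thesis using f[of l'] that by (auto simp: H_def admissible_def extendable_def)
    next
      case False
      have known: "f l'' = degen_act X s m y l''" if "l'' \<in> H" "\<not> degenerate m l''" for l''
        using f[of l''] that by (auto simp: H_def admissible_def)
      have "l' \<in> vertex_lists m" using that by (simp add: H_def)
      then have "fills (degen_act X s m y) l' (f l')" using degen_act_known known[OF that False] False by simp
      then show ?thesis
        using known H_del[OF that] del_nondegenerate[OF \<open>l' \<in> vertex_lists m\<close> False]
        by (auto simp: fills_def)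
    qed
    have del0: "del c l \<in> H" if "c < length l" for c
      using precedes_del[OF l that] del_in_vertex_lists[OF l(1) that] len by (simp add: H_def)
    have outer: "del c (block_list m pre q' b) \<in> H"
      if "c < length (block_list m pre q' b)" "c < ?i \<or> ?i + q' \<le> c" "block_list m pre q' b \<in> vertex_lists m" "2 \<le> q'"
      for c q'
      using precedes_off_block[OF D(3,4) _ D(2) that(4,1,2)] del_in_vertex_lists[OF that(3,1)] l(2) D(1) that(4)
      by (auto simp: H_def block_list_def)
    have iv: "dup ?i l \<in> vertex_lists m" "dup ?i (dup ?i l) \<in> vertex_lists m"
      using dup_in_vertex_lists[OF l(1), of ?i] dup_in_vertex_lists[of "dup ?i l" m ?i] D(2) llen by auto
    have del1: "del c (dup ?i l) \<in> H" if "c \<le> length l" "c < ?i \<or> ?i + q < c" for c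
      using outer[of c "Suc q"] iv(1) that D(2) unfolding d1 by (auto simp: llen block_list_def)
    have del2: "del c (dup ?i (dup ?i l)) \<in> H" if "c \<le> Suc (length l)" "c < ?i \<or> Suc (?i + q) < c" for c
      using outer[of c "Suc (Suc q)"] iv(2) that D(2) unfolding d2 by (auto simp: llen block_list_def)
    have edge: "f [l ! ?i, l ! ?i] \<in> s0 ` simplices X 0"
    proof -
      have lb: "l ! ?i = b" using nthl D(2) by simp
      have bb: "[b, b] \<in> vertex_lists m" using D(3) by (auto simp: vertex_lists_def)
      show ?thesis
      proof (cases "m = 0")
        case True
        then have "b = 0" "pre = []" using D(3,4) by (auto simp: neq_Nil_conv)
        have bl: "[0, 0] = block_list m [] 2 0" using True by (simp add: block_list_def numeral_2_eq_2)
        have "degenerate m [0, 0]" using True by (auto simp: degenerate_def repeats_at_def)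
        moreover have "head_length [0, 0] = 0"
          using head_length_block_list[of 0 m "[]" 2] unfolding bl by simp
        ultimately have "precedes m [0, 0] l" using l(2) h len \<open>pre = []\<close> by (auto simp: precedes_def)
        then have "f [0, 0] = s0 y"
          using f bb \<open>degenerate m [0, 0]\<close> \<open>b = 0\<close> by (auto simp: admissible_def)
        then show ?thesis using lb \<open>b = 0\<close> y True by simp
      next
        case False
        then have nd: "\<not> degenerate m [b, b]" using singleton_eq_atMost[of b m] by (auto simp: degenerate_def)
        then have "f [b, b] = degen_act X s m y [b, b]"
          using f[of "[b, b]"] bb l(2) by (auto simp: precedes_def admissible_def)
        then show ?thesis using degen_act_vertex_pair[OF D(3)] False lb by simp
      qed
    qed
    have "\<exists>u0. fills f l u0"
    proof (cases "q = 2")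
      case True
      have "repeats_at l ?i" using nthl[of ?i] nthl[of "Suc ?i"] llen True by (auto simp: repeats_at_def)
      then show ?thesis
        using filler_of_repeated_vertex[OF H H_del H_fills l(1) _ len del0 del1 edge] True by simp
    next
      case False
      let ?l = "block_list m pre (q - 1) b"
      have q: "2 \<le> q - 1" using False D(2) by simp
      have dg: "degenerate m ?l" using degenerate_block_list[OF D(3,4) _ _ q, of q] l(2) D(1,2) by simp
      have "precedes m ?l l" using precedes_block[OF D(3,4), of q] l(2) D(1,2) by simp
      moreover have "?l \<in> vertex_lists m"
        using del_in_vertex_lists[OF l(1), of ?i] del_block[OF D(3,4), of ?i q] D(1,2) llen by simp
      ultimately have "extendable f ?l (f ?l)" using f[of ?l] dg by (auto simp: admissible_def)
      moreover have "dup (head_length ?l) ?l = l"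
        using head_length_block_list[OF D(3,4) q] dup_block[OF D(3,4), of "q - 1"] D(1,2) q by simp
      ultimately show ?thesis by (auto simp: extendable_def)
    qed
    then obtain u0 where u0: "fills f l u0" ..
    have lH: "l \<notin> H" by (auto simp: H_def precedes_def)
    have "\<exists>r v. fills f l r \<and> fills (f(l := r)) (dup ?i l) v"
      by (rule replace_filler[OF H H_del H_fills l(1) len lH _ _ _ u0 del0 del1 del2 edge, of q])
        (use D(2) nthl llen in auto)
    then show ?thesis using l False h by (auto simp: admissible_def extendable_def)
  qed
qed (auto simp: admissible_def)

lemma degenerate_simplices_exist:
  obtains G where "\<And>l. l \<in> vertex_lists m \<Longrightarrow> fills G l (G l)"
    "\<And>l. \<lbrakk>l \<in> vertex_lists m; \<not> degenerate m l\<rbrakk> \<Longrightarrow> G l = degen_act X s m y l"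
    "m = 0 \<Longrightarrow> G [0, 0] = s0 y"
proof -
  have "\<exists>G. \<forall>l. admissible G l (G l)"
  proof (rule dependent_wf_choice[OF wf_precedes[of m]])
    show "admissible f l r = admissible g l r" if "\<And>l'. (l', l) \<in> {(l', l). precedes m l' l} \<Longrightarrow> f l' = g l'"
      for f g l r
      by (rule admissible_cong) (rule that, simp)
    show "\<exists>r. admissible f l r"
      if "\<And>l'. (l', l) \<in> {(l', l). precedes m l' l} \<Longrightarrow> admissible f l' (f l')" for f l
      by (rule admissible_step) (rule that, simp)
  qed
  then obtain G where G: "\<And>l. admissible G l (G l)" by blast
  have known: "G l = degen_act X s m y l" if "l \<in> vertex_lists m" "\<not> degenerate m l" for l
    using G[of l] that by (simp add: admissible_def)
  have "fills G l (G l)" if l: "l \<in> vertex_lists m" for l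
  proof (cases "degenerate m l")
    case True
    then show ?thesis using G[of l] l by (simp add: admissible_def extendable_def)
  next
    case False
    then show ?thesis
      using degen_act_known[OF l False] known[OF l False] known del_in_vertex_lists[OF l] del_nondegenerate[OF l False]
      by (auto simp: fills_def)
  qed
  moreover have "G [0, 0] = s0 y" if "m = 0"
  proof -
    have "[0, 0] \<in> vertex_lists m" "degenerate m [0, 0]"
      using that by (auto simp: vertex_lists_def degenerate_def repeats_at_def)
    then show ?thesis using G[of "[0, 0]"] by (simp add: admissible_def)
  qed
  ultimately show ?thesis using that known by blast
qed

end

section \<open>Attaching simplices to a simplicial subset\<close>

lemma eq_if_del_eq:
  assumes "length l = length l'" "Suc i < length l" "del i l = del i l'" "del (Suc i) l = del (Suc i) l'"
  shows "l = l'"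
proof (rule nth_equalityI[OF assms(1)])
  fix k assume k: "k < length l"
  have d: "del i l ! k' = del i l' ! k'" "del (Suc i) l ! k' = del (Suc i) l' ! k'" for k' using assms by auto
  show "l ! k = l' ! k"
    using d(1)[of k] d(1)[of "k - 1"] d(2)[of i] assms(1,2) k
    by (cases k i rule: linorder_cases) (auto simp: nth_del split: if_splits)
qed

lemma distinct_surjective:
  assumes "l \<in> vertex_lists m" "set l = {..m}" "distinct l"
  shows "l = [0..<Suc m]"
proof (rule sorted_distinct_set_unique)
  show "sorted l" using assms(1) by (simp add: vertex_lists_def)
  show "set l = set [0..<Suc m]" using assms(2) by (simp only: atLeast_upt atMost_upto lessThan_Suc_atMost)
qed (use assms(3) sorted_upt distinct_upt in blast)+

lemma nonrepeating_surjective: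
  "\<lbrakk>l \<in> vertex_lists m; set l = {..m}; \<nexists>i. repeats_at l i\<rbrakk> \<Longrightarrow> l = [0..<Suc m]"
  by (intro distinct_surjective distinct_if_nonrepeating) (simp_all add: vertex_lists_def)

lemma shortest_surjective:
  "\<lbrakk>l \<in> vertex_lists m; set l = {..m}; length l = Suc m\<rbrakk> \<Longrightarrow> l = [0..<Suc m]"
  by (intro distinct_surjective card_distinct) simp_all

context lifting_problem
begin

definition stage :: "nat \<Rightarrow> (nat \<Rightarrow> 'a set) \<Rightarrow> (nat \<Rightarrow> nat \<Rightarrow> 'a \<Rightarrow> 'a) \<Rightarrow> bool" where
  "stage m B s \<longleftrightarrow> simplicial_subset X B s \<and>
     (\<forall>n. \<forall>i\<le>n. \<forall>x\<in>B n. p (Suc n) (s n i x) = sY n i (p n x)) \<and>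
     (\<forall>x\<in>B 0. s 0 0 x = s0 x) \<and> (\<forall>k<m. simplices X k \<subseteq> B k)"

definition extends ::
  "(nat \<Rightarrow> 'a set) \<Rightarrow> (nat \<Rightarrow> nat \<Rightarrow> 'a \<Rightarrow> 'a) \<Rightarrow> (nat \<Rightarrow> 'a set) \<Rightarrow> (nat \<Rightarrow> nat \<Rightarrow> 'a \<Rightarrow> 'a) \<Rightarrow> bool" where
  "extends B' s' B s \<longleftrightarrow> (\<forall>n. B n \<subseteq> B' n) \<and> (\<forall>n. \<forall>i\<le>n. \<forall>x\<in>B n. s' n i x = s n i x)"

lemma extends_trans: "\<lbrakk>extends B'' s'' B' s'; extends B' s' B s\<rbrakk> \<Longrightarrow> extends B'' s'' B s"
  unfolding extends_def by (metis subset_iff)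

text \<open>
  The outcome of the recursion for one simplex, as far as it concerns \<open>B\<close> and \<open>p\<close>: this form refers neither to
  the action of lists nor to the invariant.
\<close>

definition degeneracy_family ::
  "(nat \<Rightarrow> 'a set) \<Rightarrow> (nat \<Rightarrow> nat \<Rightarrow> 'a \<Rightarrow> 'a) \<Rightarrow> nat \<Rightarrow> 'a \<Rightarrow> (nat list \<Rightarrow> 'a) \<Rightarrow> bool" where
  "degeneracy_family B s m y G \<longleftrightarrow>
     (\<forall>l\<in>vertex_lists m. G l \<in> simplices X (length l - 1) \<and>
        (\<forall>j<length l. 2 \<le> length l \<longrightarrow> face X (length l - 1) j (G l) = G (del j l)) \<and>
        (\<forall>j<length l. p (length l) (G (dup j l)) = sY (length l - 1) j (p (length l - 1) (G l))) \<and>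
        (set l \<noteq> {..m} \<longrightarrow> G l \<in> B (length l - 1) \<and> (\<forall>j<length l. G (dup j l) = s (length l - 1) j (G l)))) \<and>
      G [0..<Suc m] = y \<and> (m = 0 \<longrightarrow> G [0, 0] = s0 y)"

lemma degeneracy_familyD:
  assumes "degeneracy_family B s m y G"
  shows "l \<in> vertex_lists m \<Longrightarrow> G l \<in> simplices X (length l - 1)"
    and "\<lbrakk>l \<in> vertex_lists m; j < length l; 2 \<le> length l\<rbrakk>
      \<Longrightarrow> face X (length l - 1) j (G l) = G (del j l)"
    and "\<lbrakk>l \<in> vertex_lists m; j < length l\<rbrakk>
      \<Longrightarrow> p (length l) (G (dup j l)) = sY (length l - 1) j (p (length l - 1) (G l))"
    and "\<lbrakk>l \<in> vertex_lists m; set l \<noteq> {..m}\<rbrakk> \<Longrightarrow> G l \<in> B (length l - 1)"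
    and "\<lbrakk>l \<in> vertex_lists m; set l \<noteq> {..m}; j < length l\<rbrakk>
      \<Longrightarrow> G (dup j l) = s (length l - 1) j (G l)"
    and "G [0..<Suc m] = y" "m = 0 \<Longrightarrow> G [0, 0] = s0 y"
  using assms unfolding degeneracy_family_def by blast+

lemma degeneracies_of_new_simplex:
  assumes st: "stage m B s" and y: "y \<in> simplices X m"
  shows "\<exists>G. degeneracy_family B s m y G"
proof -
  interpret attaching_simplex X Y p sY s0 B s m y
    using st y by unfold_locales (auto simp: stage_def)
  obtain G where G: "\<And>l. l \<in> vertex_lists m \<Longrightarrow> fills G l (G l)"
    "\<And>l. \<lbrakk>l \<in> vertex_lists m; \<not> degenerate m l\<rbrakk> \<Longrightarrow> G l = degen_act X s m y l"
    "m = 0 \<Longrightarrow> G [0, 0] = s0 y"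
    by (rule degenerate_simplices_exist) blast
  have "p (length l) (G (dup j l)) = sY (length l - 1) j (p (length l - 1) (G l))"
    if "l \<in> vertex_lists m" "j < length l" for l j
    using G(1)[OF that(1)] G(1)[OF dup_in_vertex_lists[OF that]] target_dup[OF that] that(2) by (simp add: fills_def)
  moreover have "G l \<in> B (length l - 1) \<and> (\<forall>j<length l. G (dup j l) = s (length l - 1) j (G l))"
    if l: "l \<in> vertex_lists m" "set l \<noteq> {..m}" for l
  proof -
    have "set l \<subset> {..m}" using l by (auto simp: vertex_lists_def)
    note F = faces_in_proper_subset[OF this]
    have "\<not> degenerate m l" "\<And>j. j < length l \<Longrightarrow> \<not> degenerate m (dup j l)" using l(2) by (auto simp: degenerate_def)
    then show ?thesis
      using G(2) l(1) dup_in_vertex_lists[OF l(1)] degen_act_in_subset[OF B F l(1)] degeneracy_degen_act[OF B F l(1)]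
      by simp
  qed
  moreover have "G [0..<Suc m] = y"
  proof -
    let ?l = "[0..<Suc m]"
    have "?l \<in> vertex_lists m" by (auto simp: vertex_lists_def simp del: upt_Suc)
    moreover have nr: "\<nexists>i. repeats_at ?l i" by (auto simp: repeats_at_def simp del: upt_Suc)
    moreover have "(\<lambda>k\<in>{..m}. ?l ! k) = (\<lambda>k\<in>{..m}. k)" by (auto simp: fun_eq_iff simp del: upt_Suc)
    ultimately show ?thesis
      using G(2)[of ?l] degen_act_nonrepeating[OF nr, of X s m y] semisimplicial_setD(2)[OF X y]
      by (auto simp: degenerate_def simp del: upt_Suc)
  qed
  ultimately show ?thesis
    unfolding degeneracy_family_def
    using G(1,3) by (intro exI[of _ G]) (simp add: fills_def del: upt_Suc)
qed

text \<open>
  A simplex \<open>G y l\<close> with \<open>l\<close> surjective determines \<open>y\<close> and \<open>l\<close>: deleting either of two equal adjacent entries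
  of \<open>l\<close> reduces this to shorter lists, and no such simplex lies in \<open>B\<close>, as \<open>y\<close> is one of its iterated faces.
  So setting \<open>s\<^sub>j (G y l) = G y (dup j l)\<close> is unambiguous and consistent with the degeneracies on \<open>B\<close>, and the
  simplicial identities hold since they hold for lists.
\<close>

lemma stage_Suc:
  assumes st: "stage m B s"
  shows "\<exists>B' s'. stage (Suc m) B' s' \<and> extends B' s' B s"
proof -
  define N where "N = simplices X m - B m"
  have BX: "simplicial_subset X B s" using st by (simp add: stage_def)
  note Bd = simplicial_subsetD[OF BX]
  have "\<exists>G. \<forall>y\<in>N. degeneracy_family B s m y (G y)"
    using degeneracies_of_new_simplex[OF st] by (intro bchoice ballI) (simp add: N_def)
  then obtain G where "\<And>y. y \<in> N \<Longrightarrow> degeneracy_family B s m y (G y)" by blast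
  note G = degeneracy_familyD[OF this]
  have new: "G y l \<notin> B (length l - 1)" if "y \<in> N" "l \<in> vertex_lists m" "set l = {..m}" for y l
    using that
  proof (induction "length l" arbitrary: l rule: less_induct)
    case less
    show ?case
    proof (cases "\<exists>i. repeats_at l i")
      case True
      then obtain i where i: "repeats_at l i" ..
      then have len: "Suc i < length l" by (simp add: repeats_at_def)
      have "G y (del i l) \<notin> B (length (del i l) - 1)"
        using less(1)[of "del i l"] del_in_vertex_lists[OF less(3), of i] set_del[OF i] less(2,4) len by simp
      moreover have "face X (length l - 1) i (G y l) = G y (del i l)" using G(2)[OF less(2,3), of i] len by simp
      moreover have "1 \<le> length l - 1" "i \<le> length l - 1" "length (del i l) = length l - 1" using len by auto
      ultimately show ?thesis using Bd(2)[of "length l - 1" i "G y l"] by auto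
    next
      case False
      then show ?thesis
        using nonrepeating_surjective[OF less(3,4)] G(6)[OF less(2)] less(2)
        by (auto simp: N_def simp del: upt_Suc)
    qed
  qed
  have inj: "y = y' \<and> l = l'"
    if "y \<in> N" "l \<in> vertex_lists m" "set l = {..m}" "y' \<in> N" "l' \<in> vertex_lists m" "set l' = {..m}"
      "length l = length l'" "G y l = G y' l'" for y l y' l'
    using that
  proof (induction "length l" arbitrary: l l' rule: less_induct)
    case less
    show ?case
    proof (cases "\<exists>i. repeats_at l i")
      case True
      then obtain i where i: "repeats_at l i" ..
      then have len: "Suc i < length l" by (simp add: repeats_at_def)
      have *: "y = y' \<and> del k l = del k l'" if k: "k = i \<or> k = Suc i" for k
      proof -
        have kl: "k < length l" "k < length l'" "2 \<le> length l" "2 \<le> length l'" using k len less(8) by auto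
        have dl: "del k l \<in> vertex_lists m" "del k l' \<in> vertex_lists m"
          using del_in_vertex_lists less(3,6) kl by auto
        have sl: "set (del k l) = {..m}" using k set_del[OF i] del_Suc[OF i] less(4) by auto
        have e: "G y (del k l) = G y' (del k l')"
          using G(2)[OF less(2,3) kl(1,3)] G(2)[OF less(5,6) kl(2,4)] less(8,9) by simp
        have "G y (del k l) \<notin> B (length (del k l) - 1)" using new[OF less(2) dl(1) sl] .
        then have "set (del k l') = {..m}"
          using G(4)[OF less(5) dl(2)] e kl less(8) by auto
        then show ?thesis
          using less(1)[OF _ less(2) dl(1) sl less(5) dl(2) _ _ e] kl less(8) by simp
      qed
      show ?thesis using *[of i] *[of "Suc i"] eq_if_del_eq[OF less(8) len] by simp
    next
      case False
      then have l: "l = [0..<Suc m]" using nonrepeating_surjective less by blast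
      then have "l' = [0..<Suc m]" using shortest_surjective[OF less(6,7)] less(8) by simp
      then show ?thesis using l less(9) G(6)[OF less(2)] G(6)[OF less(5)] by simp
    qed
  qed
  define B' where "B' k = B k \<union> {z. \<exists>y l. y \<in> N \<and> l \<in> vertex_lists m \<and> length l = Suc k \<and> z = G y l}" for k
  define s' where "s' k j z = (if z \<in> B k then s k j z else
      (let yl = (SOME yl. fst yl \<in> N \<and> snd yl \<in> vertex_lists m \<and> length (snd yl) = Suc k \<and> z = G (fst yl) (snd yl))
       in G (fst yl) (dup j (snd yl))))" for k j z
  have sB: "s' k j z = s k j z" if "z \<in> B k" for k j z using that by (simp add: s'_def)
  have sG: "s' k j (G y l) = G y (dup j l)"
    if y: "y \<in> N" and l: "l \<in> vertex_lists m" "length l = Suc k" and j: "j \<le> k" for k j y l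
  proof (cases "set l = {..m}")
    case True
    let ?P = "\<lambda>yl. fst yl \<in> N \<and> snd yl \<in> vertex_lists m \<and> length (snd yl) = Suc k \<and> G y l = G (fst yl) (snd yl)"
    define yl where "yl = (SOME yl. ?P yl)"
    have P: "?P yl" unfolding yl_def using y l by (intro someI[of ?P "(y, l)"]) simp
    have nB: "G y l \<notin> B k" using new[OF y l(1) True] l(2) by simp
    have "set (snd yl) = {..m}" using G(4)[of "fst yl" "snd yl"] P nB by auto
    then have yl: "y = fst yl \<and> l = snd yl" using P l(2) by (intro inj[OF y l(1) True]) simp_all
    have "s' k j (G y l) = G (fst yl) (dup j (snd yl))"
      unfolding s'_def yl_def Let_def if_not_P[OF nB] ..
    then show ?thesis by (simp only: yl[THEN conjunct1, symmetric] yl[THEN conjunct2, symmetric])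
  next
    case False
    then show ?thesis using G(4)[OF y l(1)] G(5)[OF y l(1)] sB[of "G y l" k j] l(2) j by simp
  qed
  have cases': "z \<in> B k \<or> (\<exists>y l. y \<in> N \<and> l \<in> vertex_lists m \<and> length l = Suc k \<and> z = G y l)" if "z \<in> B' k" for z k
    using that by (auto simp: B'_def)
  have GB': "G y l \<in> B' k" if "y \<in> N" "l \<in> vertex_lists m" "length l = Suc k" for y l k
    using that by (auto simp: B'_def)
  have BB': "z \<in> B' k" if "z \<in> B k" for z k using that by (simp add: B'_def)
  have fG: "face X (Suc k) j (G y l) = G y (del j l)" "del j l \<in> vertex_lists m" "length (del j l) = Suc k"
    if "y \<in> N" "l \<in> vertex_lists m" "length l = Suc (Suc k)" "j \<le> Suc k" for y l j k
    using G(2)[OF that(1,2), of j] that(3,4) del_in_vertex_lists[OF that(2), of j] by auto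
  have dG: "dup j l \<in> vertex_lists m" "length (dup j l) = Suc (length l)"
    if "l \<in> vertex_lists m" "j < length l" for l j
    using dup_in_vertex_lists[OF that] that(2) by auto
  have "simplicial_structure (X\<lparr>simplices := B'\<rparr>) s'"
    unfolding simplicial_structure_def face_simplices_update
  proof (intro conjI allI impI ballI funcsetI; simp)
    fix n i x assume i: "i \<le> n" and x: "x \<in> B' n"
    show "s' n i x \<in> B' (Suc n)"
      using cases'[OF x]
    proof (elim disjE exE conjE)
      assume "x \<in> B n" then show ?thesis using sB Bd(3)[OF i] BB' by simp
    next
      fix y l assume "y \<in> N" "l \<in> vertex_lists m" "length l = Suc n" "x = G y l"
      then show ?thesis using sG[of y l n i] i dG[of l i] GB'[of y "dup i l" "Suc n"] by simp
    qed
  next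
    fix n j i x assume i: "j \<le> n" "i < j" and x: "x \<in> B' n"
    then obtain n' where n': "n = Suc n'" by (cases n) auto
    show "face X (Suc n) i (s' n j x) = s' (n - Suc 0) (j - Suc 0) (face X n i x)"
      using cases'[OF x]
    proof (elim disjE exE conjE)
      assume "x \<in> B n" then show ?thesis using sB Bd(2)[of n i x] Bd(4)[OF i(2,1)] i by simp
    next
      fix y l assume yl: "y \<in> N" "l \<in> vertex_lists m" "length l = Suc n" "x = G y l"
      have "face X (Suc n) i (s' n j x) = G y (del i (dup j l))"
        using sG[OF yl(1-3) i(1)] fG(1)[OF yl(1), of "dup j l" n i] dG[OF yl(2), of j] yl i by simp
      also have "del i (dup j l) = dup (j - 1) (del i l)" using i yl(3) by (intro del_dup_less) auto
      also have "G y \<dots> = s' n' (j - 1) (face X n i x)"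
        using fG[OF yl(1,2), of n' i] sG[OF yl(1), of "del i l" n' "j - 1"] yl i n' by simp
      finally show ?thesis using n' by simp
    qed
  next
    fix n j x assume j: "j \<le> n" and x: "x \<in> B' n"
    show "face X (Suc n) j (s' n j x) = x"
      using cases'[OF x]
    proof (elim disjE exE conjE)
      assume "x \<in> B n" then show ?thesis using sB Bd(5)[OF j] by simp
    next
      fix y l assume yl: "y \<in> N" "l \<in> vertex_lists m" "length l = Suc n" "x = G y l"
      then show ?thesis
        using sG[OF yl(1-3) j] fG(1)[OF yl(1), of "dup j l" n j] dG[OF yl(2), of j] j del_dup_same[of j l] by simp
    qed
    show "face X (Suc n) (Suc j) (s' n j x) = x"
      using cases'[OF x]
    proof (elim disjE exE conjE)
      assume "x \<in> B n" then show ?thesis using sB Bd(6)[OF j] by simp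
    next
      fix y l assume yl: "y \<in> N" "l \<in> vertex_lists m" "length l = Suc n" "x = G y l"
      then show ?thesis
        using sG[OF yl(1-3) j] fG(1)[OF yl(1), of "dup j l" n "Suc j"] dG[OF yl(2), of j] j
          del_Suc_dup_same[of j l] by simp
    qed
  next
    fix n i j x assume i: "i \<le> Suc n" "Suc j < i" and x: "x \<in> B' n"
    then obtain n' where n': "n = Suc n'" by (cases n) auto
    show "face X (Suc n) i (s' n j x) = s' (n - Suc 0) j (face X n (i - Suc 0) x)"
      using cases'[OF x]
    proof (elim disjE exE conjE)
      assume "x \<in> B n" then show ?thesis using sB Bd(2)[of n "i - 1" x] Bd(7)[OF i(2,1)] i by simp
    next
      fix y l assume yl: "y \<in> N" "l \<in> vertex_lists m" "length l = Suc n" "x = G y l"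
      have "face X (Suc n) i (s' n j x) = G y (del i (dup j l))"
        using sG[OF yl(1-3), of j] fG(1)[OF yl(1), of "dup j l" n i] dG[OF yl(2), of j] yl i by simp
      also have "del i (dup j l) = dup j (del (i - 1) l)" using i yl(3) by (intro del_dup_greater) auto
      also have "G y \<dots> = s' n' j (face X n (i - 1) x)"
        using fG[OF yl(1,2), of n' "i - 1"] sG[OF yl(1), of "del (i - 1) l" n' j] yl i n' by simp
      finally show ?thesis using n' by simp
    qed
  next
    fix n j i x assume i: "j \<le> n" "i \<le> j" and x: "x \<in> B' n"
    show "s' (Suc n) i (s' n j x) = s' (Suc n) (Suc j) (s' n i x)"
      using cases'[OF x]
    proof (elim disjE exE conjE)
      assume "x \<in> B n" then show ?thesis using sB Bd(3)[of j n x] Bd(3)[of i n x] Bd(8)[OF i(2,1)] i by simp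
    next
      fix y l assume yl: "y \<in> N" "l \<in> vertex_lists m" "length l = Suc n" "x = G y l"
      then show ?thesis
        using sG[OF yl(1-3), of j] sG[OF yl(1-3), of i] sG[OF yl(1), of "dup j l" "Suc n" i]
          sG[OF yl(1), of "dup i l" "Suc n" "Suc j"] dG[OF yl(2), of i] dG[OF yl(2), of j] i
          dup_dup[of i j l] by simp
    qed
  qed
  moreover have "B' n \<subseteq> simplices X n" for n
    using Bd(1) G(1) by (force simp: B'_def)
  moreover have "face X n i ` B' n \<subseteq> B' (n - 1)" if n: "1 \<le> n" "i \<le> n" for n i
  proof (intro image_subsetI)
    fix x assume x: "x \<in> B' n"
    obtain n' where n': "n = Suc n'" using n by (cases n) auto
    show "face X n i x \<in> B' (n - 1)"
      using cases'[OF x]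
    proof (elim disjE exE conjE)
      assume "x \<in> B n" then show ?thesis using Bd(2)[OF n] BB' by simp
    next
      fix y l assume yl: "y \<in> N" "l \<in> vertex_lists m" "length l = Suc n" "x = G y l"
      then show ?thesis using fG[OF yl(1,2), of n' i] GB'[OF yl(1), of "del i l" n'] n n' by simp
    qed
  qed
  ultimately have "simplicial_subset X B' s'" by (simp add: simplicial_subset_def)
  moreover have "p (Suc n) (s' n i x) = sY n i (p n x)" if i: "i \<le> n" and x: "x \<in> B' n" for n i x
    using cases'[OF x]
  proof (elim disjE exE conjE)
    assume "x \<in> B n" then show ?thesis using sB st i by (simp add: stage_def)
  next
    fix y l assume yl: "y \<in> N" "l \<in> vertex_lists m" "length l = Suc n" "x = G y l"
    then show ?thesis using sG[OF yl(1-3) i] G(3)[OF yl(1,2), of i] i by simp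
  qed
  moreover have "s' 0 0 x = s0 x" if x: "x \<in> B' 0" for x
  proof (cases "x \<in> B 0")
    case True
    then show ?thesis using sB st by (simp add: stage_def)
  next
    case False
    then obtain y l where yl: "y \<in> N" "l \<in> vertex_lists m" "length l = Suc 0" "x = G y l"
      using cases'[OF x] by blast
    obtain b where b: "l = [b]" using yl(3) by (auto simp: length_Suc_conv)
    have "set l = {..m}" using G(4)[OF yl(1,2)] False yl(3,4) by auto
    then have m: "m = 0" "l = [0]" using b singleton_eq_atMost[of b m] by auto
    then have "x = y" using G(6)[OF yl(1)] yl(4) by simp
    then show ?thesis using sG[OF yl(1-3), of 0] G(7)[OF yl(1) m(1)] yl(4) m by (simp add: dup_def)
  qed
  moreover have "simplices X k \<subseteq> B' k" if "k < Suc m" for k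
  proof (cases "k = m")
    case True
    have "[0..<Suc m] \<in> vertex_lists m" by (auto simp: vertex_lists_def simp del: upt_Suc)
    then have "y \<in> B' m" if "y \<in> N" for y
      using GB'[OF that, of "[0..<Suc m]" m] G(6)[OF that] by simp
    then show ?thesis using True BB' by (auto simp: N_def)
  next
    case False
    then have "simplices X k \<subseteq> B k" using that st by (simp add: stage_def)
    then show ?thesis using BB' by blast
  qed
  moreover have "extends B' s' B s" using sB BB' by (auto simp: extends_def)
  ultimately show ?thesis unfolding stage_def by blast
qed

text \<open>
  The union of the stages: the \<open>n\<close>-simplices are all present from stage \<open>n + 1\<close> on, and their degeneracies do
  not change any more.
\<close>

lemma simplicial_structure_from_stage:
  assumes st: "stage 0 B s"
  shows "\<exists>sX. simplicial_structure X sX \<and> (\<forall>x\<in>simplices X 0. sX 0 0 x = s0 x) \<and>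
    (\<forall>n. \<forall>i\<le>n. \<forall>x\<in>B n. sX n i x = s n i x) \<and>
    (\<forall>n. \<forall>i\<le>n. \<forall>x\<in>simplices X n. p (Suc n) (sX n i x) = sY n i (p n x))"
proof -
  have "\<exists>T. \<forall>n. (stage n (fst (T n)) (snd (T n)) \<and> extends (fst (T n)) (snd (T n)) B s) \<and>
      extends (fst (T (Suc n))) (snd (T (Suc n))) (fst (T n)) (snd (T n))"
  proof (rule dependent_nat_choice)
    show "\<exists>T. stage 0 (fst T) (snd T) \<and> extends (fst T) (snd T) B s"
      using st by (intro exI[of _ "(B, s)"]) (simp add: extends_def)
    fix T n assume T: "stage n (fst T) (snd T) \<and> extends (fst T) (snd T) B s"
    then obtain B' s' where "stage (Suc n) B' s'" "extends B' s' (fst T) (snd T)" using stage_Suc by blast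
    then show "\<exists>T'. (stage (Suc n) (fst T') (snd T') \<and> extends (fst T') (snd T') B s) \<and>
        extends (fst T') (snd T') (fst T) (snd T)"
      using T extends_trans by (intro exI[of _ "(B', s')"]) auto
  qed
  then obtain T where T: "\<And>n. stage n (fst (T n)) (snd (T n))" "\<And>n. extends (fst (T n)) (snd (T n)) B s"
    "\<And>n. extends (fst (T (Suc n))) (snd (T (Suc n))) (fst (T n)) (snd (T n))" by blast
  have mono: "extends (fst (T n')) (snd (T n')) (fst (T n)) (snd (T n))" if "n \<le> n'" for n n'
    using that
  proof (induction n' rule: dec_induct)
    case base
    show ?case by (simp add: extends_def)
  next
    case (step n')
    then show ?case using extends_trans T(3) by blast
  qed
  define sX where "sX n = snd (T (Suc n)) n" for n
  have all: "x \<in> fst (T k) n \<longleftrightarrow> x \<in> simplices X n" if "n < k" for x n k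
    using T(1)[of k] that simplicial_subsetD(1)[of X "fst (T k)" "snd (T k)" x n] by (auto simp: stage_def)
  have agree: "sX n i x = snd (T k) n i x" if "n < k" "i \<le> n" "x \<in> simplices X n" for n i x k
    using mono[of "Suc n" k] all[of n "Suc n" x] that by (simp add: extends_def sX_def)
  have sub: "simplicial_subset X (fst (T k)) (snd (T k))" for k using T(1)[of k] by (simp add: stage_def)
  have "simplicial_structure X sX"
    unfolding simplicial_structure_def
  proof (intro conjI allI impI ballI funcsetI)
    fix n i x assume i: "i \<le> n" and x: "x \<in> simplices X n"
    show "sX n i x \<in> simplices X (Suc n)"
      using agree[of n "Suc (Suc n)" i x] all[of n "Suc (Suc n)"] all[of "Suc n" "Suc (Suc n)"]
        simplicial_subsetD(3)[OF sub i, of x "Suc (Suc n)"] i x by simp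
  next
    fix n j i x assume i: "j \<le> n" "i < j" and x: "x \<in> simplices X n"
    have "face X n i x \<in> simplices X (n - 1)" using face_in_simplices[OF X _ _ x, of i] i by simp
    then show "face X (Suc n) i (sX n j x) = sX (n - 1) (j - 1) (face X n i x)"
      using agree[of n "Suc n" j x] agree[of "n - 1" "Suc n" "j - 1"] all[of n "Suc n"]
        simplicial_subsetD(4)[OF sub i(2,1), of x "Suc n"] i x by simp
  next
    fix n j x assume j: "j \<le> n" and x: "x \<in> simplices X n"
    show "face X (Suc n) j (sX n j x) = x" "face X (Suc n) (Suc j) (sX n j x) = x"
      using agree[of n "Suc n" j x] all[of n "Suc n"] simplicial_subsetD(5,6)[OF sub j, of x "Suc n"] j x by simp_all
  next
    fix n i j x assume i: "i \<le> Suc n" "Suc j < i" and x: "x \<in> simplices X n"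
    have "face X n (i - 1) x \<in> simplices X (n - 1)" using face_in_simplices[OF X _ _ x, of "i - 1"] i by simp
    then show "face X (Suc n) i (sX n j x) = sX (n - 1) j (face X n (i - 1) x)"
      using agree[of n "Suc n" j x] agree[of "n - 1" "Suc n" j] all[of n "Suc n"]
        simplicial_subsetD(7)[OF sub i(2,1), of x "Suc n"] i x by simp
  next
    fix n j i x assume i: "j \<le> n" "i \<le> j" and x: "x \<in> simplices X n"
    let ?k = "Suc (Suc n)"
    have "snd (T ?k) n j x \<in> simplices X (Suc n)" "snd (T ?k) n i x \<in> simplices X (Suc n)"
      using simplicial_subsetD(3)[OF sub, of _ n x ?k] all[of n ?k] all[of "Suc n" ?k] i x by simp_all
    then show "sX (Suc n) i (sX n j x) = sX (Suc n) (Suc j) (sX n i x)"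
      using agree[of n ?k j x] agree[of n ?k i x] agree[of "Suc n" ?k] all[of n ?k]
        simplicial_subsetD(8)[OF sub i(2,1), of x ?k] i x by simp
  qed
  moreover have "sX 0 0 x = s0 x" if "x \<in> simplices X 0" for x
    using T(1)[of 1] all[of 0 1] that by (simp add: sX_def stage_def)
  moreover have "sX n i x = s n i x" if "i \<le> n" "x \<in> B n" for n i x
    using T(2)[of "Suc n"] that by (simp add: sX_def extends_def)
  moreover have "p (Suc n) (sX n i x) = sY n i (p n x)" if "i \<le> n" "x \<in> simplices X n" for n i x
    using T(1)[of "Suc n"] all[of n "Suc n"] that by (simp add: sX_def stage_def)
  ultimately show ?thesis by blast
qed

end

theorem theorem2p1:
  fixes X A :: "'a semisimplicial" and Y :: "'b semisimplicial"
    and p :: "nat \<Rightarrow> 'a \<Rightarrow> 'b"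
    and sA :: "nat \<Rightarrow> nat \<Rightarrow> 'a \<Rightarrow> 'a" and sY :: "nat \<Rightarrow> nat \<Rightarrow> 'b \<Rightarrow> 'b"
    and s0 :: "'a \<Rightarrow> 'a"
  assumes "semisimplicial_set X" and "semisimplicial_set Y"
    and "inner_fibration X Y p"
    and "semisimplicial_subset A X"
    and "simplicial_structure Y sY" and "simplicial_structure A sA"
    and "simplicial_map A sA Y sY (\<lambda>n. p n \<circ> inclusion n)"
    and "s0 \<in> simplices X 0 \<rightarrow> simplices X 1"
    and "\<And>a. a \<in> simplices A 0 \<Longrightarrow> s0 (inclusion 0 a) = inclusion 1 (sA 0 0 a)"
    and "\<And>x. x \<in> simplices X 0 \<Longrightarrow> p 1 (s0 x) = sY 0 0 (p 0 x)"
    and "\<And>x. x \<in> simplices X 0 \<Longrightarrow> edge_from_to X (s0 x) x x"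
    and "\<And>x. x \<in> simplices X 0 \<Longrightarrow> idempotent X Y sY p (s0 x)"
    and "\<And>x. x \<in> simplices X 0 \<Longrightarrow> cartesian X Y p (s0 x)"
    and "\<And>x. x \<in> simplices X 0 \<Longrightarrow> cocartesian X Y p (s0 x)"
  shows "\<exists>sX. simplicial_structure X sX \<and>
           (\<forall>x\<in>simplices X 0. sX 0 0 x = s0 x) \<and>
           simplicial_map A sA X sX inclusion \<and>
           simplicial_map X sX Y sY p"
proof -
  interpret lifting_problem X Y p sY s0
    using assms(1-3,5,8,10-14) by unfold_locales auto
  have AX: "semisimplicial_set A" "\<And>n a. a \<in> simplices A n \<Longrightarrow> a \<in> simplices X n"
    "\<And>m n \<alpha> a. \<lbrakk>\<alpha> \<in> inj_maps m n; a \<in> simplices A n\<rbrakk> \<Longrightarrow> act A m n \<alpha> a = act X m n \<alpha> a"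
    using assms(4) by (auto simp: semisimplicial_subset_def)
  have fA: "face X n i a = face A n i a" if "1 \<le> n" "i \<le> n" "a \<in> simplices A n" for n i a
    using AX(3)[OF coface_in_inj_maps[OF that(1,2)] that(3)] by (simp add: face_def)
  have sA: "sA n i a \<in> simplices A (Suc n)" if "i \<le> n" "a \<in> simplices A n" for n i a
    using assms(6) that by (auto simp: simplicial_structure_def)
  have "simplicial_structure (X\<lparr>simplices := simplices A\<rparr>) sA"
    using assms(6) sA fA unfolding simplicial_structure_def by simp
  then have "simplicial_subset X (simplices A) sA"
    using AX(2) fA face_in_simplices[OF AX(1)] by (auto simp: simplicial_subset_def)
  then have "stage 0 (simplices A) sA"
    using assms(7,9) by (simp add: stage_def simplicial_map_def inclusion_def)
  then obtain sX where sX: "simplicial_structure X sX" "\<forall>x\<in>simplices X 0. sX 0 0 x = s0 x"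
    "\<forall>n. \<forall>i\<le>n. \<forall>x\<in>simplices A n. sX n i x = sA n i x"
    "\<forall>n. \<forall>i\<le>n. \<forall>x\<in>simplices X n. p (Suc n) (sX n i x) = sY n i (p n x)"
    using simplicial_structure_from_stage by blast
  moreover have "simplicial_map A sA X sX inclusion"
    using AX sX(3) by (simp add: simplicial_map_def semisimplicial_map_def inclusion_def)
  moreover have "simplicial_map X sX Y sY p"
    using p_map sX(4) by (simp add: simplicial_map_def)
  ultimately show ?thesis by blast
qed

end
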